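(* Let $d, m \geq 1$ be integers, let $\lambda = (\lambda_1, \dots, \lambda_m)$ be a weight, let $-\infty \leq p \leq 1/d$, and let $\beta = (\beta_1, \dots, \beta_m) \in (\mathbb{R} \setminus \{0\})^m$. For integrable functions $f_1, \dots, f_m, g_1, \dots, g_m \colon \mathbb{R}^d \to \mathbb{R}_{\geq 0}$ with $0 < \| f_i \|_1 < \infty$ for every $i$, put $S = S(f_1) \times \dots \times S(f_m)$ and $$K_\beta = \operatorname*{ess\,inf}_{x = (x_1, \dots, x_m) \in S} M_p^\lambda \left( \frac{g_1(z_\beta(x))}{f_1(x_1)}, \dots, \frac{g_m(z_\beta(x))}{f_m(x_m)} \right),$$ the essential infimum being with respect to Lebesgue measure on $S$. Then the following hold. (1) The least constant $C$ such that $$K_\beta \leq C \, M_{Q_d(p)}^\lambda \left( \left( \frac{\lambda_1}{|\beta_1|} \right)^d \frac{\| g_1 \|_1}{\| f_1 \|_1}, \dots, \left( \frac{\lambda_m}{|\beta_m|} \right)^d \frac{\| g_m \|_1}{\| f_m \|_1} \right)$$ holds for all such functions $f_1, \dots, f_m, g_1, \dots, g_m$ is $C = 1$. (2) If $m \geq 2$, then for every $-\infty \leq \widetilde{Q} < Q_d(p)$ the inequality $$K_\beta \leq M_{\widetilde{Q}}^\lambda \left( \left( \frac{\lambda_1}{|\beta_1|} \right)^d \frac{\| g_1 \|_1}{\| f_1 \|_1}, \dots, \left( \frac{\lambda_m}{|\beta_m|} \right)^d \frac{\| g_m \|_1}{\| f_m \|_1} \right)$$ does not hold for all such functions $f_1,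 \dots, f_m, g_1, \dots, g_m$.
   Context: A weight is a tuple $\lambda = (\lambda_1, \dots, \lambda_m)$ of positive real numbers with $\sum_{i=1}^m \lambda_i = 1$. For a weight $\lambda$ and $-\infty \leq p \leq \infty$, the weighted power mean $M_p^\lambda \colon \mathbb{R}_{\geq 0}^m \to \mathbb{R}_{\geq 0}$ is defined by: $M_0^\lambda(a) = \prod_{i=1}^m a_i^{\lambda_i}$; $M_{-\infty}^\lambda(a) = \min_i a_i$; $M_\infty^\lambda(a) = \max_i a_i$; $M_p^\lambda(a) = 0$ if $-\infty \leq p \leq 0$ and $\prod_{i=1}^m a_i = 0$; and $M_p^\lambda(a) = \left( \sum_{i=1}^m \lambda_i a_i^p \right)^{1/p}$ otherwise. For $x = (x_1, \dots, x_m) \in (\mathbb{R}^d)^m$, $z_\beta(x) = \sum_{i=1}^m \beta_i x_i \in \mathbb{R}^d$; $\beta$ is not assumed to be a weight. For $f \colon \mathbb{R}^d \to \mathbb{R}_{\geq 0}$, $S(f) = \{ x \in \mathbb{R}^d \mid f(x) > 0 \}$, and $\| f \|_1$ is the $L^1$ norm with respect to Lebesgue measure. The power transform $Q_d \colon [-\infty, 1/d] \to [-\infty, \infty]$ is $Q_d(p) = \frac{p}{1 - dp}$ for $-\infty < p < 1/d$, $Q_d(-\infty) = -1/d$, and $Q_d(1/d) = \infty$. *)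

theory Defs
  imports "HOL-Analysis.Analysis"
begin

text \<open>
  Tuples of length m, including elements of the m-fold power of a Euclidean space, are vectors
  indexed by a finite type of cardinality m.
\<close>

definition is_weight :: "real ^ 'm \<Rightarrow> bool" where
  "is_weight w \<longleftrightarrow> (\<forall>i. 0 < w $ i) \<and> (\<Sum>i\<in>UNIV. w $ i) = 1"

text \<open>
  Only meant for tuples \<open>a\<close> with nonnegative entries, on which the overlapping clauses of the usual
  definition agree. Note that \<open>0 powr t = 0\<close>, which is the right value for \<open>t > 0\<close>; the remaining
  occurrences of a zero base are caught by the clause for negative \<open>p\<close>.
\<close>

definition power_mean :: "real ^ 'm \<Rightarrow> ereal \<Rightarrow> real ^ 'm \<Rightarrow> real" where
  "power_mean w p a =
     (if p = 0 then \<Prod>i\<in>UNIV. (a $ i) powr (w $ i)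
      else if p = -\<infinity> then Min (range (\<lambda>i. a $ i))
      else if p = \<infinity> then Max (range (\<lambda>i. a $ i))
      else if p < 0 \<and> (\<Prod>i\<in>UNIV. a $ i) = 0 then 0
      else (\<Sum>i\<in>UNIV. w $ i * (a $ i) powr real_of_ereal p) powr (1 / real_of_ereal p))"

text \<open>Only meant for \<open>p \<le> 1 / d\<close> with \<open>d \<ge> 1\<close>.\<close>

definition power_transform :: "nat \<Rightarrow> ereal \<Rightarrow> ereal" where
  "power_transform d p =
     (if p = -\<infinity> then ereal (- 1 / real d)
      else if p = ereal (1 / real d) then \<infinity>
      else ereal (real_of_ereal p / (1 - real d * real_of_ereal p)))"

definition L1_norm :: "('a::euclidean_space \<Rightarrow> real) \<Rightarrow> real" where
  "L1_norm f = (\<integral>x. \<bar>f x\<bar> \<partial>lebesgue)"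

definition pos_set :: "('a \<Rightarrow> real) \<Rightarrow> 'a set" where
  "pos_set f = {x. 0 < f x}"

definition pos_prod :: "('m \<Rightarrow> 'a \<Rightarrow> real) \<Rightarrow> ('a ^ 'm) set" where
  "pos_prod f = {x. \<forall>i. x $ i \<in> pos_set (f i)}"

definition lin_comb :: "real ^ 'm \<Rightarrow> ('a::real_vector) ^ 'm \<Rightarrow> 'a" where
  "lin_comb b x = (\<Sum>i\<in>UNIV. b $ i *\<^sub>R x $ i)"

definition ess_inf :: "'a measure \<Rightarrow> ('a \<Rightarrow> ereal) \<Rightarrow> ereal" where
  "ess_inf M h = Sup {c. AE x in M. c \<le> h x}"

definition K_const ::
  "real ^ 'm \<Rightarrow> ereal \<Rightarrow> real ^ 'm \<Rightarrow>
     ('m \<Rightarrow> real ^ 'd \<Rightarrow> real) \<Rightarrow> ('m \<Rightarrow> real ^ 'd \<Rightarrow> real) \<Rightarrow> ereal" where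
  "K_const w p b f g =
     ess_inf (lebesgue_on (pos_prod f))
       (\<lambda>x. ereal (power_mean w p (\<chi> i. g i (lin_comb b x) / f i (x $ i))))"

definition norm_ratios ::
  "real ^ 'm \<Rightarrow> real ^ 'm \<Rightarrow>
     ('m \<Rightarrow> real ^ 'd \<Rightarrow> real) \<Rightarrow> ('m \<Rightarrow> real ^ 'd \<Rightarrow> real) \<Rightarrow> real ^ 'm" where
  "norm_ratios w b f g =
     (\<chi> i. (w $ i / \<bar>b $ i\<bar>) ^ CARD('d) * (L1_norm (g i) / L1_norm (f i)))"

text \<open>Finiteness of the \<open>L\<^sup>1\<close> norms is part of \<^const>\<open>integrable\<close>.\<close>

definition admissible ::
  "('m \<Rightarrow> 'a::euclidean_space \<Rightarrow> real) \<Rightarrow> ('m \<Rightarrow> 'a \<Rightarrow> real) \<Rightarrow> bool" where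
  "admissible f g \<longleftrightarrow>
     (\<forall>i. (\<forall>x. 0 \<le> f i x) \<and> (\<forall>x. 0 \<le> g i x) \<and>
          integrable lebesgue (f i) \<and> integrable lebesgue (g i) \<and> 0 < L1_norm (f i))"

definition is_least :: "'a::order set \<Rightarrow> 'a \<Rightarrow> bool" where
  "is_least A c \<longleftrightarrow> c \<in> A \<and> (\<forall>y\<in>A. c \<le> y)"

end

theory Submission
  imports Defs
begin

text \<open>
  In dimension one, truncate each \<open>f i\<close> at a level \<open>\<sigma> i\<close> that it reaches on a set of positive
  measure. The hypothesis puts the weighted sums of the superlevel sets \<open>{f i \<ge> s \<sigma> i}\<close>, up to null
  sets, into \<open>{M\<^sub>p (g / \<sigma>) \<ge> c s}\<close>. The Brunn-Minkowski inequality on the line, integrated over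
  \<open>0 < s < 1\<close>, bounds \<open>\<integral> M\<^sub>p (g / \<sigma>)\<close> from below, and Hoelder's inequality
  \<open>M\<^sub>p(x) \<le> M\<^sub>Q(a) \<cdot> \<Sum> w\<^sub>i x\<^sub>i / a\<^sub>i\<close> with \<open>Q = p / (1 - p)\<close>, taken at the vector \<open>a\<close> of norm ratios,
  bounds it from above. The case of dimension \<open>d\<close> follows by Fubini, one coordinate at a time, because
  \<open>p \<mapsto> p / (1 - d p)\<close> is the \<open>d\<close>-fold iterate of \<open>p \<mapsto> p / (1 - p)\<close>. Indicator functions of
  concentric cubes, with sizes chosen for equality in Hoelder's inequality, show that the constant
  and the exponent are optimal.
\<close>

section \<open>Weighted power means\<close>

text \<open>Null sets of tuples split over coordinates by Fubini, but null sets of points z are not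
  pulled back to tuples. The bounds therefore carry a predicate \<open>R\<close> that holds for
  almost every z, and the exceptional z are added to the target set. \<open>R\<close> absorbs both
  the Borel modifications of the g_i and the slices on which a marginal of g_i is infinite.

  The truncation levels \<sigma>_i never have to be compared with each other. With T = \<Sum> |b_i|
  ||f_i|| / \<sigma>_i, Brunn-Minkowski gives the lower bound c r T, where the factor r < 1 is the
  price of truncating. At the vector of norm ratios, the sum in Hoelder's inequality integrates to
  at most the same T. So T cancels, and r tends to 1. The levels must be reached on sets of positive
  measure, since an empty summand would destroy the Brunn-Minkowski bound.\<close>

lemma power_mean_0: "power_mean w 0 a = (\<Prod>i\<in>UNIV. (a $ i) powr (w $ i))"
  by (simp add: power_mean_def)

lemma power_mean_minfty: "power_mean w (-\<infinity>) a = Min (range (($) a))"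
  by (simp add: power_mean_def)

lemma power_mean_infty: "power_mean w \<infinity> a = Max (range (($) a))"
  by (simp add: power_mean_def)

lemma power_mean_real:
  "r \<noteq> 0 \<Longrightarrow> power_mean w (ereal r) a =
    (if r < 0 \<and> (\<exists>i. a $ i = 0) then 0 else (\<Sum>i\<in>UNIV. w $ i * a $ i powr r) powr (1 / r))"
  by (auto simp: power_mean_def zero_ereal_def)

lemma weightD:
  assumes "is_weight w"
  shows "0 < w $ i" "(\<Sum>i\<in>UNIV. w $ i) = 1"
  using assms by (auto simp: is_weight_def)

lemma power_mean_cases [case_names zero minfty infty real]:
  fixes p :: ereal
  assumes "p = 0 \<Longrightarrow> P" "p = -\<infinity> \<Longrightarrow> P" "p = \<infinity> \<Longrightarrow> P" "\<And>r. p = ereal r \<Longrightarrow> r \<noteq> 0 \<Longrightarrow> P"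
  shows P
  using assms by (cases p) (auto simp: zero_ereal_def)

lemma power_mean_nonneg:
  assumes "\<And>i. 0 \<le> a $ i"
  shows "0 \<le> power_mean w p a"
proof (cases p rule: power_mean_cases)
  case infty
  have "0 \<le> a $ undefined" by fact
  also have "\<dots> \<le> Max (range (($) a))" by (intro Max_ge) auto
  finally show ?thesis by (simp add: infty power_mean_infty)
qed (use assms in \<open>auto simp: power_mean_0 power_mean_minfty power_mean_real intro!: prod_nonneg\<close>)

lemma power_mean_mono:
  assumes w: "is_weight w" and a: "\<And>i. 0 \<le> a $ i" and ab: "\<And>i. a $ i \<le> b $ i"
  shows "power_mean w p a \<le> power_mean w p b"
proof (cases p rule: power_mean_cases)
  case zero
  show ?thesis
    unfolding zero power_mean_0
    by (intro prod_mono) (use a ab weightD(1)[OF w] in \<open>simp add: powr_mono2 less_imp_le\<close>)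
next
  case minfty
  have "Min (range (($) a)) \<le> b $ i" for i
    using ab[of i] by (meson Min_le finite finite_imageI order_trans rangeI)
  then show ?thesis by (simp add: minfty power_mean_minfty)
next
  case infty
  have "a $ i \<le> Max (range (($) b))" for i
    using ab[of i] by (meson Max_ge finite finite_imageI order_trans rangeI)
  then show ?thesis by (simp add: infty power_mean_infty)
next
  case (real r)
  show ?thesis
  proof (cases "r > 0")
    case True
    have "(\<Sum>i\<in>UNIV. w $ i * a $ i powr r) \<le> (\<Sum>i\<in>UNIV. w $ i * b $ i powr r)"
      by (intro sum_mono mult_left_mono powr_mono2)
        (use True a ab weightD(1)[OF w] in \<open>auto intro: less_imp_le\<close>)
    moreover have "0 \<le> (\<Sum>i\<in>UNIV. w $ i * a $ i powr r)"
      by (intro sum_nonneg mult_nonneg_nonneg) (use weightD(1)[OF w] in \<open>auto intro: less_imp_le\<close>)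
    ultimately show ?thesis
      using True by (simp add: real power_mean_real powr_mono2)
  next
    case False
    show ?thesis
    proof (cases "\<exists>i. a $ i = 0")
      case True
      have "0 \<le> power_mean w p b" by (intro power_mean_nonneg) (use a ab order_trans in blast)
      with True False show ?thesis by (simp add: real power_mean_real)
    next
      case nz: False
      have ap: "0 < a $ i" for i using a[of i] nz by (metis less_eq_real_def)
      have bp: "0 < b $ i" for i using ap ab by (metis order_less_le_trans)
      have "(\<Sum>i\<in>UNIV. w $ i * b $ i powr r) \<le> (\<Sum>i\<in>UNIV. w $ i * a $ i powr r)"
        by (intro sum_mono mult_left_mono powr_mono2')
          (use False ap ab weightD(1)[OF w] in \<open>auto intro: less_imp_le\<close>)
      moreover have "0 < (\<Sum>i\<in>UNIV. w $ i * b $ i powr r)"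
        by (intro sum_pos mult_pos_pos) (use weightD(1)[OF w] bp in \<open>auto simp: less_imp_neq[symmetric]\<close>)
      ultimately show ?thesis
        using False nz bp[THEN less_imp_neq] real(2)
        by (auto simp: real power_mean_real powr_mono2')
    qed
  qed
qed

lemma power_mean_scale:
  assumes w: "is_weight w" and k: "0 < k" and a: "\<And>i. 0 \<le> a $ i"
  shows "power_mean w p (k *\<^sub>R a) = k * power_mean w p a"
proof (cases p rule: power_mean_cases)
  case zero
  have "(\<Prod>i\<in>UNIV. k powr (w $ i)) = k"
    using k weightD(2)[OF w] by (simp flip: powr_sum)
  then show ?thesis
    using k a by (simp add: zero power_mean_0 powr_mult prod.distrib)
next
  case minfty
  have "mono ((*) k)" using k by (intro monoI) simp
  then have "k * Min (range (($) a)) = Min ((*) k ` range (($) a))"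
    by (intro mono_Min_commute) auto
  then show ?thesis by (simp add: minfty power_mean_minfty image_image)
next
  case infty
  have "mono ((*) k)" using k by (intro monoI) simp
  then have "k * Max (range (($) a)) = Max ((*) k ` range (($) a))"
    by (intro mono_Max_commute) auto
  then show ?thesis by (simp add: infty power_mean_infty image_image)
next
  case (real r)
  have "(\<Sum>i\<in>UNIV. w $ i * (k * a $ i) powr r) = k powr r * (\<Sum>i\<in>UNIV. w $ i * a $ i powr r)"
    using k a by (simp add: powr_mult sum_distrib_left mult_ac)
  moreover have "0 \<le> (\<Sum>i\<in>UNIV. w $ i * a $ i powr r)"
    by (intro sum_nonneg mult_nonneg_nonneg) (use weightD(1)[OF w] in \<open>auto intro: less_imp_le\<close>)
  ultimately show ?thesis
    using k real(2) by (auto simp: real power_mean_real powr_mult powr_powr)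
qed

lemma power_mean_const:
  assumes w: "is_weight w" and "0 < k"
  shows "power_mean w p (\<chi> i. k) = k"
proof (cases p rule: power_mean_cases)
  case zero
  then show ?thesis using assms weightD(2)[OF w] by (simp add: power_mean_0 flip: powr_sum)
next
  case (real r)
  then show ?thesis
    using assms weightD(2)[OF w] by (simp add: power_mean_real powr_powr flip: sum_distrib_right)
qed (auto simp: power_mean_minfty power_mean_infty image_constant_conv)

lemma borel_measurable_power_mean:
  assumes [measurable]: "\<And>i. (\<lambda>x. g x $ i) \<in> borel_measurable M"
  shows "(\<lambda>x. power_mean w p (g x)) \<in> borel_measurable M"
  by (cases p rule: power_mean_cases)
    (simp_all add: power_mean_0 power_mean_minfty power_mean_infty power_mean_real)

section \<open>Arithmetic-geometric mean and Hoelder inequalities\<close>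

text \<open>Normalising by the arithmetic mean \<open>S\<close>, sum the inequality ln y \<le> y - 1
  at y = x_i / S: the weighted right-hand sides add up to 0.\<close>

lemma weighted_arith_geom_mean:
  assumes w: "is_weight w" and x: "\<And>i. 0 \<le> x i"
  shows "(\<Prod>i\<in>UNIV. x i powr w $ i) \<le> (\<Sum>i\<in>UNIV. w $ i * x i)"
proof (cases "\<exists>i. x i = 0")
  case True
  then have "(\<Prod>i\<in>UNIV. x i powr w $ i) = 0" by (auto simp: prod_zero_iff)
  also have "0 \<le> (\<Sum>i\<in>UNIV. w $ i * x i)"
    by (intro sum_nonneg mult_nonneg_nonneg) (use weightD(1)[OF w] x in \<open>auto intro: less_imp_le\<close>)
  finally show ?thesis .
next
  case False
  then have xp: "0 < x i" for i using x[of i] by (metis less_eq_real_def)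
  define S where "S = (\<Sum>i\<in>UNIV. w $ i * x i)"
  have S: "0 < S" unfolding S_def by (intro sum_pos mult_pos_pos) (use weightD(1)[OF w] xp in auto)
  have "(\<Sum>i\<in>UNIV. w $ i * ln (x i)) \<le> (\<Sum>i\<in>UNIV. w $ i * (ln S + (x i / S - 1)))"
  proof (intro sum_mono mult_left_mono)
    fix i
    have "ln (x i / S) \<le> x i / S - 1" by (intro ln_le_minus_one) (use xp S in auto)
    then show "ln (x i) \<le> ln S + (x i / S - 1)" using xp[of i] S by (simp add: ln_div)
  qed (use weightD(1)[OF w] in \<open>auto intro: less_imp_le\<close>)
  also have "\<dots> = ln S * (\<Sum>i\<in>UNIV. w $ i) + ((\<Sum>i\<in>UNIV. w $ i * (x i / S)) - (\<Sum>i\<in>UNIV. w $ i))"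
    by (simp add: algebra_simps sum.distrib sum_subtractf sum_distrib_left)
  also have "(\<Sum>i\<in>UNIV. w $ i * (x i / S)) = S / S" by (simp add: S_def flip: sum_divide_distrib)
  also have "ln S * (\<Sum>i\<in>UNIV. w $ i) + (S / S - (\<Sum>i\<in>UNIV. w $ i)) = ln S" using S weightD(2)[OF w] by simp
  finally have "exp (\<Sum>i\<in>UNIV. w $ i * ln (x i)) \<le> S" using S by (metis exp_le_cancel_iff exp_ln)
  then show ?thesis using xp by (simp add: S_def exp_sum powr_def less_imp_neq[symmetric])
qed

lemma Young_powr:
  fixes u v :: real
  assumes "0 \<le> u" "0 \<le> v" "0 < \<alpha>" "\<alpha> < 1"
  shows "u powr \<alpha> * v powr (1 - \<alpha>) \<le> \<alpha> * u + (1 - \<alpha>) * v"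
  using assms Youngs_inequality_0[of \<alpha> "1 - \<alpha>" u v] by (cases "u = 0 \<or> v = 0") auto

text \<open>Young's inequality for \<open>u i / U\<close> and \<open>v i / V\<close>, whose weighted
  sums are 1. If \<open>U\<close> or \<open>V\<close> vanishes, every term on the left vanishes as
  well.\<close>

lemma Hoelder_sum:
  fixes w u v :: "'m \<Rightarrow> real"
  assumes w: "\<And>i. i \<in> I \<Longrightarrow> 0 \<le> w i" and u: "\<And>i. i \<in> I \<Longrightarrow> 0 \<le> u i" and v: "\<And>i. i \<in> I \<Longrightarrow> 0 \<le> v i"
    and \<alpha>: "0 < \<alpha>" "\<alpha> < 1" and fin: "finite I"
  shows "(\<Sum>i\<in>I. w i * (u i powr \<alpha> * v i powr (1 - \<alpha>))) \<le>
    (\<Sum>i\<in>I. w i * u i) powr \<alpha> * (\<Sum>i\<in>I. w i * v i) powr (1 - \<alpha>)"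
proof -
  define U V where "U = (\<Sum>i\<in>I. w i * u i)" and "V = (\<Sum>i\<in>I. w i * v i)"
  have UV: "0 \<le> U" "0 \<le> V" unfolding U_def V_def using w u v by (auto intro!: sum_nonneg)
  consider "U = 0" | "V = 0" | "U > 0" "V > 0" using UV by fastforce
  then show ?thesis
  proof cases
    case 1
    then have "\<forall>i\<in>I. w i * u i = 0"
      unfolding U_def using w u by (subst (asm) sum_nonneg_eq_0_iff) (auto simp: fin)
    then have "(\<Sum>i\<in>I. w i * (u i powr \<alpha> * v i powr (1 - \<alpha>))) = 0"
      by (intro sum.neutral) auto
    then show ?thesis by simp
  next
    case 2
    then have "\<forall>i\<in>I. w i * v i = 0"
      unfolding V_def using w v by (subst (asm) sum_nonneg_eq_0_iff) (auto simp: fin)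
    then have "(\<Sum>i\<in>I. w i * (u i powr \<alpha> * v i powr (1 - \<alpha>))) = 0"
      by (intro sum.neutral) auto
    then show ?thesis by simp
  next
    case 3
    have "(\<Sum>i\<in>I. w i * (u i powr \<alpha> * v i powr (1 - \<alpha>)))
        = U powr \<alpha> * V powr (1 - \<alpha>) * (\<Sum>i\<in>I. w i * ((u i / U) powr \<alpha> * (v i / V) powr (1 - \<alpha>)))"
      unfolding sum_distrib_left using 3 u v by (intro sum.cong) (auto simp: powr_divide field_simps)
    also have "\<dots> \<le> U powr \<alpha> * V powr (1 - \<alpha>) * (\<Sum>i\<in>I. w i * (\<alpha> * (u i / U) + (1 - \<alpha>) * (v i / V)))"
      by (intro mult_left_mono sum_mono Young_powr) (use 3 u v w \<alpha> in auto)
    also have "(\<Sum>i\<in>I. w i * (\<alpha> * (u i / U) + (1 - \<alpha>) * (v i / V))) = \<alpha> * (U / U) + (1 - \<alpha>) * (V / V)"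
    proof -
      have "(\<Sum>i\<in>I. w i * (u i / U)) = U / U" "(\<Sum>i\<in>I. w i * (v i / V)) = V / V"
        using 3 by (simp_all add: U_def V_def flip: sum_divide_distrib)
      moreover have "(\<Sum>i\<in>I. w i * (\<alpha> * (u i / U) + (1 - \<alpha>) * (v i / V)))
          = \<alpha> * (\<Sum>i\<in>I. w i * (u i / U)) + (1 - \<alpha>) * (\<Sum>i\<in>I. w i * (v i / V))"
        unfolding sum_distrib_left by (simp add: algebra_simps sum.distrib)
      ultimately show ?thesis by simp
    qed
    also have "\<dots> = 1" using 3 by simp
    finally show ?thesis by (simp add: U_def V_def)
  qed
qed

text \<open>Hoelder's inequality for the factorisation of x into a and x / a, with exponents related
  by 1/p = 1/Q + 1. Hypothesis \<open>ax\<close> makes the factorisation valid under the convention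
  y / 0 = 0.\<close>

lemma power_mean_Hoelder:
  fixes w a x :: "real ^ 'm::finite"
  assumes w: "is_weight w" and p: "p \<le> 1" and a: "\<And>i. 0 \<le> a $ i" and x: "\<And>i. 0 \<le> x $ i"
    and ax: "\<And>i. a $ i = 0 \<Longrightarrow> x $ i = 0"
  shows "power_mean w p x \<le> power_mean w (power_transform 1 p) a * (\<Sum>i\<in>UNIV. w $ i * (x $ i / a $ i))"
proof -
  define W where "W = (\<Sum>i\<in>UNIV. w $ i * (x $ i / a $ i))"
  have wp: "0 < w $ i" for i by (rule weightD(1)[OF w])
  have wn: "0 \<le> w $ i" for i using wp[of i] by simp
  have W: "0 \<le> W" unfolding W_def by (intro sum_nonneg mult_nonneg_nonneg) (use wn x a in auto)
  have xa: "x $ i = a $ i * (x $ i / a $ i)" for i using ax by auto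
  have R0: "0 \<le> power_mean w (power_transform 1 p) a * W"
    by (intro mult_nonneg_nonneg W power_mean_nonneg a)
  have "power_mean w p x \<le> power_mean w (power_transform 1 p) a * W"
  proof (cases p rule: power_mean_cases)
    case zero
    have "(\<Prod>i\<in>UNIV. x $ i powr w $ i) = (\<Prod>i\<in>UNIV. a $ i powr w $ i) * (\<Prod>i\<in>UNIV. (x $ i / a $ i) powr w $ i)"
      unfolding prod.distrib[symmetric] using a x
      by (intro prod.cong refl) (metis xa divide_nonneg_nonneg powr_mult)
    also have "\<dots> \<le> (\<Prod>i\<in>UNIV. a $ i powr w $ i) * W"
      unfolding W_def by (intro mult_left_mono weighted_arith_geom_mean w prod_nonneg) (use a x in auto)
    finally show ?thesis by (simp add: zero power_mean_0 power_transform_def zero_ereal_def[symmetric])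
  next
    case minfty
    define \<mu> where "\<mu> = Min (range (($) x))"
    have le: "\<mu> \<le> x $ i" for i unfolding \<mu>_def by (intro Min_le) auto
    show ?thesis
    proof (cases "\<exists>i. a $ i = 0")
      case True
      then have "\<mu> \<le> 0" using le ax by metis
      then show ?thesis using R0 by (simp add: minfty power_mean_minfty \<mu>_def)
    next
      case False
      then have ap: "0 < a $ i" for i using a[of i] by (metis less_eq_real_def)
      \<comment> \<open>For p = -\<infinity> the transformed exponent is -1, so
        \<open>inverse T\<close> is the weighted harmonic mean of a.\<close>
      define T where "T = (\<Sum>i\<in>UNIV. w $ i / a $ i)"
      have T: "0 < T" unfolding T_def by (intro sum_pos divide_pos_pos) (use ap wp in auto)
      have "\<mu> * T = (\<Sum>i\<in>UNIV. w $ i * (\<mu> / a $ i))" by (simp add: T_def sum_distrib_left mult_ac)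
      also have "\<dots> \<le> W" unfolding W_def
        by (intro sum_mono mult_left_mono divide_right_mono le) (use a wn in auto)
      finally have "\<mu> \<le> inverse T * W" using T by (simp add: field_simps)
      moreover have "power_mean w (power_transform 1 p) a = inverse T"
        using False T ap unfolding minfty power_transform_def
        by (simp add: power_mean_real powr_minus T_def divide_inverse less_imp_le)
      ultimately show ?thesis by (simp add: minfty power_mean_minfty \<mu>_def)
    qed
  next
    case infty
    then show ?thesis using p by simp
  next
    case (real r)
    then have r1: "r \<le> 1" using p by (simp add: one_ereal_def)
    show ?thesis
    proof (cases "r = 1")
      case True
      then have "p = 1" using real by (simp add: one_ereal_def)
      have le: "a $ i \<le> Max (range (($) a))" for i by (intro Max_ge) auto
      have "(\<Sum>i\<in>UNIV. w $ i * x $ i) \<le> (\<Sum>i\<in>UNIV. w $ i * (Max (range (($) a)) * (x $ i / a $ i)))"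
        by (intro sum_mono mult_left_mono wn, subst xa, rule mult_right_mono[OF le]) (use a x in auto)
      also have "\<dots> = Max (range (($) a)) * W" by (simp add: W_def sum_distrib_left mult_ac)
      finally have "(\<Sum>i\<in>UNIV. w $ i * x $ i) \<le> Max (range (($) a)) * W" .
      moreover have "0 \<le> (\<Sum>i\<in>UNIV. w $ i * x $ i)" by (intro sum_nonneg mult_nonneg_nonneg wn x)
      ultimately show ?thesis
        using True x by (simp add: real(1) power_mean_real power_transform_def power_mean_infty)
    next
      case False
      with r1 have r1: "r < 1" by simp
      define q where "q = r / (1 - r)"
      have Q: "power_transform 1 p = ereal q" using real(1) False by (simp add: power_transform_def q_def)
      have q0: "q \<noteq> 0" using real(2) False by (simp add: q_def)
      show ?thesis
      proof (cases "r > 0")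
        case True
        have qpos: "q > 0" using True r1 by (simp add: q_def)
        define S where "S = (\<Sum>i\<in>UNIV. w $ i * a $ i powr q)"
        have S: "0 \<le> S" unfolding S_def by (intro sum_nonneg mult_nonneg_nonneg wn) auto
        \<comment> \<open>The conjugate weights are \<open>1 - r\<close> and \<open>r\<close>; the
          factor a^r is the power \<open>1 - r\<close> of a^q because q (1 - r) = r.\<close>
        have "(\<Sum>i\<in>UNIV. w $ i * x $ i powr r) = (\<Sum>i\<in>UNIV. w $ i * ((a $ i powr q) powr (1 - r) * (x $ i / a $ i) powr (1 - (1 - r))))"
        proof (intro sum.cong refl arg_cong2[where f="(*)"])
          fix i
          have "(a $ i powr q) powr (1 - r) = a $ i powr r" using r1 by (simp add: powr_powr q_def)
          then show "x $ i powr r = (a $ i powr q) powr (1 - r) * (x $ i / a $ i) powr (1 - (1 - r))"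
            using xa[of i] a[of i] x[of i] powr_mult[of "a $ i" "x $ i / a $ i" r] by simp
        qed
        also have "\<dots> \<le> S powr (1 - r) * W powr (1 - (1 - r))"
          unfolding S_def W_def by (intro Hoelder_sum wn) (use a x r1 True in auto)
        finally have "(\<Sum>i\<in>UNIV. w $ i * x $ i powr r) powr (1 / r) \<le> (S powr (1 - r) * W powr r) powr (1 / r)"
          using True by (intro powr_mono2 sum_nonneg mult_nonneg_nonneg wn) auto
        also have "\<dots> = S powr (1 / q) * W"
          using True S W r1 by (simp add: powr_mult powr_powr q_def)
        finally show ?thesis unfolding Q using True qpos real q0 by (simp add: power_mean_real S_def)
      next
        case False
        then have rneg: "r < 0" using real(2) by simp
        show ?thesis
        proof (cases "\<exists>i. x $ i = 0")
          case True
          then show ?thesis using R0 rneg by (simp add: real(1) power_mean_real)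
        next
          case False
          then have xp: "0 < x $ i" for i using x[of i] by (metis less_eq_real_def)
          then have ap: "0 < a $ i" for i using a[of i] ax[of i] by (metis less_eq_real_def)
          have qneg: "q < 0" using rneg r1 by (simp add: q_def divide_neg_pos)
          \<comment> \<open>For r < 0 the roles change: now the sum \<open>S\<close> of the a_i^q is
            the mixed one, written with x^r and x / a, and Hoelder bounds it from above. The
            negative exponent \<open>1 / q\<close> turns this into a lower bound for the mean of
            a.\<close>
          define \<alpha> where "\<alpha> = 1 / (1 - r)"
          have \<alpha>: "0 < \<alpha>" "\<alpha> < 1" using rneg by (auto simp: \<alpha>_def field_simps)
          define X where "X = (\<Sum>i\<in>UNIV. w $ i * x $ i powr r)"
          define S where "S = (\<Sum>i\<in>UNIV. w $ i * a $ i powr q)"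
          have X: "0 < X" unfolding X_def by (intro sum_pos mult_pos_pos wp) (use xp in \<open>auto simp: less_imp_neq[symmetric]\<close>)
          have Wp: "0 < W" unfolding W_def by (intro sum_pos mult_pos_pos wp) (use xp ap in auto)
          have Sp: "0 < S" unfolding S_def by (intro sum_pos mult_pos_pos wp) (use ap in \<open>auto simp: less_imp_neq[symmetric]\<close>)
          have e1: "r * \<alpha> = q" by (simp add: \<alpha>_def q_def)
          have e2: "1 - \<alpha> = - q" using r1 by (simp add: \<alpha>_def q_def field_simps)
          have "S = (\<Sum>i\<in>UNIV. w $ i * ((x $ i powr r) powr \<alpha> * (x $ i / a $ i) powr (1 - \<alpha>)))"
            unfolding S_def
          proof (intro sum.cong refl arg_cong2[where f="(*)"])
            fix i
            show "a $ i powr q = (x $ i powr r) powr \<alpha> * (x $ i / a $ i) powr (1 - \<alpha>)"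
              unfolding powr_powr e1 e2 using xp[of i] ap[of i]
              by (simp add: powr_divide powr_minus field_simps less_imp_neq[symmetric])
          qed
          also have "\<dots> \<le> X powr \<alpha> * W powr (1 - \<alpha>)"
            unfolding X_def W_def by (intro Hoelder_sum wn) (use a x \<alpha> in auto)
          finally have "(X powr \<alpha> * W powr (1 - \<alpha>)) powr (1 / q) \<le> S powr (1 / q)"
            using qneg Sp by (intro powr_mono2') auto
          also have "(X powr \<alpha> * W powr (1 - \<alpha>)) powr (1 / q) = X powr (1 / r) * W powr (-1)"
            using q0 X Wp real(2) by (simp add: powr_mult powr_powr e2 flip: e1)
          finally have "X powr (1 / r) \<le> S powr (1 / q) * W"
            using Wp by (simp add: powr_minus field_simps)
          then show ?thesis unfolding Q unfolding real(1) using rneg qneg False ap[THEN less_imp_neq, symmetric]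
            by (simp add: power_mean_real S_def X_def)
        qed
      qed
    qed
  qed
  then show ?thesis unfolding W_def .
qed

section \<open>The Brunn-Minkowski inequality on the line\<close>

lemma AE_pos_measure_ex:
  assumes "AE x in M. P x" "A \<in> sets M" "0 < emeasure M A"
  shows "\<exists>x\<in>A. P x"
proof (rule ccontr)
  assume "\<not> ?thesis"
  then have "AE x in M. x \<notin> A" by (intro eventually_mono[OF assms(1)]) auto
  then have "emeasure M A = 0" using AE_iff_null_sets[OF assms(2)] by (simp add: null_setsD1)
  then show False using assms(3) by simp
qed

text \<open>The measure of the tail is monotone and 1-Lipschitz in x, since moving x across an
  interval changes it by at most the length of the interval. By continuity it takes every value
  between 0 and the measure of A.\<close>

lemma ex_tail_measure_eq:
  fixes A :: "real set"
  assumes [measurable]: "A \<in> sets borel" and A: "A \<subseteq> {-n..n}" and e: "0 < e" "e < measure lborel A"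
  shows "\<exists>x. measure lborel (A \<inter> {x<..}) = e"
proof -
  have fin: "A \<inter> S \<in> fmeasurable lborel" if "S \<in> sets borel" for S
    by (rule fmeasurableI2[OF fmeasurable_cbox[of "-n" n]]) (use A that in auto)
  define m where "m = (\<lambda>x. measure lborel (A \<inter> {x<..}))"
  have m0: "m n = 0" using A by (auto simp: m_def intro!: measure_eq_0_null_sets null_setsI) 
      (metis Int_greaterThanAtMost atLeastAtMost_iff disjoint_iff emeasure_empty greaterThan_iff leD subset_iff)
  \<comment> \<open>Starting at \<open>-n - 1\<close> rather than \<open>-n\<close> makes the open
    tail contain all of A.\<close>
  have m1: "m (-n - 1) = measure lborel A" unfolding m_def using A by (intro arg_cong[where f="measure lborel"]) force
  have mono: "m y \<le> m x" if "x \<le> y" for x y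
    unfolding m_def using that by (intro measure_mono_fmeasurable fin) auto
  have lip: "m x \<le> m y + (y - x)" if "x \<le> y" for x y
  proof -
    have "m x \<le> measure lborel ((A \<inter> {y<..}) \<union> {x..y})"
      unfolding m_def using that by (intro measure_mono_fmeasurable fmeasurable.Un fin fmeasurable_cbox[of x y, simplified]) auto
    also have "\<dots> \<le> m y + measure lborel {x..y}" unfolding m_def by (rule measure_Un_le) auto
    finally show ?thesis using that by simp
  qed
  have d: "dist (m x) (m y) \<le> 1 * dist x y" for x y
    using lip[of x y] lip[of y x] mono[of x y] mono[of y x] by (auto simp: dist_real_def abs_if)
  have "continuous_on UNIV m"
    unfolding continuous_on_iff by (metis d mult_1 order_le_less_trans)
  moreover have "- n - 1 \<le> n" proof -
    obtain a where "a \<in> A" using e by (metis all_not_in_conv less_asym measure_empty)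
    then have "-n \<le> a" "a \<le> n" using A by auto
    then show ?thesis by simp
  qed
  ultimately have "\<exists>x. - n - 1 \<le> x \<and> x \<le> n \<and> m x = e"
    using e m0 m1 by (intro IVT2') (auto intro: continuous_on_subset)
  then show ?thesis unfolding m_def by blast
qed

text \<open>Heads of A are tails of its reflection, and Lebesgue measure is invariant under
  reflection.\<close>

lemma ex_head_measure_eq:
  fixes A :: "real set"
  assumes [measurable]: "A \<in> sets borel" and A: "A \<subseteq> {-n..n}" and e: "0 < e" "e < measure lborel A"
  shows "\<exists>x. measure lborel (A \<inter> {..<x}) = e"
proof -
  have neg: "measure lborel (uminus -` S) = measure lborel S" if "S \<in> sets borel" for S :: "real set"
  proof -
    have "distr lborel borel uminus = (lborel :: real measure)" by (rule lborel_distr_uminus)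
    then have "measure lborel S = measure (distr lborel borel (uminus :: real \<Rightarrow> real)) S" by simp
    also have "\<dots> = measure lborel (uminus -` S)" using that by (subst measure_distr) auto
    finally show ?thesis by simp
  qed
  have [measurable]: "uminus -` A \<in> sets borel" by (rule measurable_sets_borel[OF _ assms(1)]) simp
  obtain x where x: "measure lborel (uminus -` A \<inter> {x<..}) = e"
    using ex_tail_measure_eq[of "uminus -` A" n e] A e neg[of A] by fastforce
  have "uminus -` A \<inter> {x<..} = uminus -` (A \<inter> {..< -x})" by auto
  then have "measure lborel (A \<inter> {..< -x}) = e" using x neg[of "A \<inter> {..< -x}"] by simp
  then show ?thesis ..
qed

text \<open>Fubini for null sets exchanges the two quantifiers. This restores the symmetry between
  the two sets, so that a translation point can be picked from either of them.\<close>

lemma AE_commute_sum_set: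
  fixes A1 A2 B :: "real set"
  assumes [measurable]: "A1 \<in> sets borel" "A2 \<in> sets borel" "B \<in> sets borel"
    and ae: "AE v in lborel. v \<in> A1 \<longrightarrow> (AE u in lborel. u \<in> A2 \<longrightarrow> v + u \<in> B)"
  shows "AE u in lborel. u \<in> A2 \<longrightarrow> (AE v in lborel. v \<in> A1 \<longrightarrow> v + u \<in> B)"
proof -
  have "Measurable.pred (borel \<Otimes>\<^sub>M borel) (\<lambda>x. fst x \<in> A1 \<longrightarrow> snd x \<in> A2 \<longrightarrow> fst x + snd x \<in> B)"
    by measurable
  then have meas: "{x \<in> space (lborel \<Otimes>\<^sub>M lborel). fst x \<in> A1 \<longrightarrow> snd x \<in> A2 \<longrightarrow> fst x + snd x \<in> B}
      \<in> sets (lborel \<Otimes>\<^sub>M lborel)"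
    using sets_pair_measure_cong[OF sets_lborel sets_lborel]
    by (simp add: pred_def space_pair_measure)
  have "AE v in lborel. AE u in lborel. v \<in> A1 \<longrightarrow> u \<in> A2 \<longrightarrow> v + u \<in> B"
    using ae by eventually_elim auto
  then have "AE u in lborel. AE v in lborel. v \<in> A1 \<longrightarrow> u \<in> A2 \<longrightarrow> v + u \<in> B"
    using lborel_pair.AE_commute[where P="\<lambda>v u. v \<in> A1 \<longrightarrow> u \<in> A2 \<longrightarrow> v + u \<in> B"] meas by simp
  then show ?thesis by eventually_elim auto
qed

text \<open>Up to null sets, \<open>B\<close> contains a translate of \<open>A2\<close> by a point near the essential supremum
  of \<open>A1\<close> and a translate of \<open>A1\<close> by a point near the essential infimum of \<open>A2\<close>; these two are
  almost disjoint.\<close>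

lemma emeasure_sum_set_bounded:
  fixes A1 A2 B :: "real set"
  assumes [measurable]: "A1 \<in> sets borel" "A2 \<in> sets borel" "B \<in> sets borel"
    and ae: "AE v in lborel. v \<in> A1 \<longrightarrow> (AE u in lborel. u \<in> A2 \<longrightarrow> v + u \<in> B)"
    and bd: "A1 \<subseteq> {-n..n}" "A2 \<subseteq> {-n..n}" and pos: "0 < emeasure lborel A1" "0 < emeasure lborel A2"
  shows "emeasure lborel A1 + emeasure lborel A2 \<le> emeasure lborel B"
proof -
  have fin: "A1 \<inter> S \<in> fmeasurable lborel" "A2 \<inter> S \<in> fmeasurable lborel" if "S \<in> sets borel" for S
    by - (rule fmeasurableI2[OF fmeasurable_cbox[of "-n" n]]; use bd that in auto)+
  have fin0: "A1 \<in> fmeasurable lborel" "A2 \<in> fmeasurable lborel" using fin[of UNIV] by auto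
  have eq: "emeasure lborel A1 = measure lborel A1" "emeasure lborel A2 = measure lborel A2"
    using fin0 by (simp_all add: emeasure_eq_measure2)
  have pos': "0 < measure lborel A1" "0 < measure lborel A2" using pos by (simp_all add: eq)
  have trans: "emeasure lborel ((\<lambda>u. v + u) -` S) = emeasure lborel S" if [measurable]: "S \<in> sets borel" for v and S :: "real set"
    using nn_integral_real_affine[of "indicator S" 1 v]
    by (simp add: nn_integral_indicator[symmetric] indicator_def vimage_def)
  \<comment> \<open>A piece of mass e is cut off at the right end of \<open>A1\<close> and another
    at the left end of \<open>A2\<close>. The translation vectors are picked from these pieces,
    which is possible because they have positive measure; each piece costs e.\<close>
  have key: "ennreal (measure lborel A1 + measure lborel A2 - 2 * e) \<le> emeasure lborel B"
    if e: "0 < e" "e < measure lborel A1" "e < measure lborel A2" for e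
  proof -
    obtain x where x: "measure lborel (A1 \<inter> {x<..}) = e"
      using ex_tail_measure_eq[OF _ bd(1)] e by auto
    obtain y where y: "measure lborel (A2 \<inter> {..<y}) = e"
      using ex_head_measure_eq[OF _ bd(2)] e by auto
    have px: "0 < emeasure lborel (A1 \<inter> {x<..})" using x e by (subst emeasure_eq_measure2) (auto intro!: fin)
    have py: "0 < emeasure lborel (A2 \<inter> {..<y})" using y e by (subst emeasure_eq_measure2) (auto intro!: fin)
    obtain v where v: "v \<in> A1" "x < v" "AE u in lborel. u \<in> A2 \<longrightarrow> v + u \<in> B"
      using AE_pos_measure_ex[OF ae _ px] by auto
    obtain u where u: "u \<in> A2" "u < y" "AE v in lborel. v \<in> A1 \<longrightarrow> v + u \<in> B"
      using AE_pos_measure_ex[OF AE_commute_sum_set[OF _ _ _ ae] _ py] by auto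
    \<comment> \<open>As u < y, translating the part of \<open>A1\<close> up to x by u stays below x
      + y; as x < v, translating the part of \<open>A2\<close> from y on by v stays above. The
      translates thus lie in disjoint parts of B.\<close>
    let ?c = "x + y"
    have "ennreal (measure lborel (A1 \<inter> {..x})) = emeasure lborel (A1 \<inter> {..x})"
      by (subst emeasure_eq_measure2) (auto intro!: fin)
    also have "\<dots> \<le> emeasure lborel ((\<lambda>v. u + v) -` (B \<inter> {..<?c}))"
      by (intro emeasure_mono_AE) (use u in \<open>auto simp: add_ac elim!: eventually_mono\<close>)
    also have "\<dots> = emeasure lborel (B \<inter> {..<?c})" by (rule trans) simp
    finally have 1: "ennreal (measure lborel (A1 \<inter> {..x})) \<le> emeasure lborel (B \<inter> {..<?c})" .
    have "ennreal (measure lborel (A2 \<inter> {y..})) = emeasure lborel (A2 \<inter> {y..})"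
      by (subst emeasure_eq_measure2) (auto intro!: fin)
    also have "\<dots> \<le> emeasure lborel ((\<lambda>u. v + u) -` (B \<inter> {?c..}))"
      by (intro emeasure_mono_AE) (use v in \<open>auto elim!: eventually_mono\<close>)
    also have "\<dots> = emeasure lborel (B \<inter> {?c..})" by (rule trans) simp
    finally have 2: "ennreal (measure lborel (A2 \<inter> {y..})) \<le> emeasure lborel (B \<inter> {?c..})" .
    have "A1 \<inter> {x<..} \<union> A1 \<inter> {..x} = A1" by auto
    then have "measure lborel A1 \<le> e + measure lborel (A1 \<inter> {..x})"
      using measure_Un_le[of "A1 \<inter> {x<..}" lborel "A1 \<inter> {..x}"] x by simp
    moreover have "A2 \<inter> {..<y} \<union> A2 \<inter> {y..} = A2" by auto
    then have "measure lborel A2 \<le> e + measure lborel (A2 \<inter> {y..})"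
      using measure_Un_le[of "A2 \<inter> {..<y}" lborel "A2 \<inter> {y..}"] y by simp
    ultimately have "ennreal (measure lborel A1 + measure lborel A2 - 2 * e)
        \<le> ennreal (measure lborel (A1 \<inter> {..x}) + measure lborel (A2 \<inter> {y..}))"
      by (intro ennreal_leI) simp
    also have "\<dots> \<le> emeasure lborel (B \<inter> {..<?c}) + emeasure lborel (B \<inter> {?c..})"
      using add_mono[OF 1 2] by (simp add: ennreal_plus)
    also have "\<dots> = emeasure lborel (B \<inter> {..<?c} \<union> B \<inter> {?c..})"
      by (rule plus_emeasure) auto
    also have "B \<inter> {..<?c} \<union> B \<inter> {?c..} = B" by auto
    finally show ?thesis .
  qed
  have "((\<lambda>e. ennreal (measure lborel A1 + measure lborel A2 - 2 * e)) \<longlongrightarrow>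
      ennreal (measure lborel A1 + measure lborel A2 - 2 * 0)) (at_right 0)"
    by (intro tendsto_ennrealI tendsto_intros)
  moreover have "\<forall>\<^sub>F e in at_right 0. e < min (measure lborel A1) (measure lborel A2)"
    using pos' by (intro order_tendstoD(2)[OF tendsto_ident_at]) auto
  then have "\<forall>\<^sub>F e in at_right 0. ennreal (measure lborel A1 + measure lborel A2 - 2 * e) \<le> emeasure lborel B"
    using eventually_at_right_less[of 0] by eventually_elim (auto intro!: key)
  ultimately have "ennreal (measure lborel A1 + measure lborel A2 - 2 * 0) \<le> emeasure lborel B"
    by (rule tendsto_upperbound) simp
  then show ?thesis by (simp add: eq ennreal_plus)
qed

text \<open>Intersect with growing intervals: the truncated sets eventually have positive measure,
  and the bounded case passes to the limit, infinite measures included.\<close>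

lemma emeasure_sum_set:
  fixes A1 A2 B :: "real set"
  assumes [measurable]: "A1 \<in> sets borel" "A2 \<in> sets borel" "B \<in> sets borel"
    and ae: "AE v in lborel. v \<in> A1 \<longrightarrow> (AE u in lborel. u \<in> A2 \<longrightarrow> v + u \<in> B)"
    and pos: "0 < emeasure lborel A1" "0 < emeasure lborel A2"
  shows "emeasure lborel A1 + emeasure lborel A2 \<le> emeasure lborel B"
proof -
  have lim: "(\<lambda>n. emeasure lborel (A \<inter> {-real n..real n})) \<longlonglongrightarrow> emeasure lborel A" if "A \<in> sets borel" for A
  proof -
    have "(\<Union>n. A \<inter> {-real n..real n}) = A"
      by (auto simp: abs_le_iff[symmetric] minus_le_iff intro: real_arch_simple)
        (metis abs_le_iff minus_le_iff real_arch_simple)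
    moreover have "(\<lambda>n. emeasure lborel (A \<inter> {-real n..real n})) \<longlonglongrightarrow> emeasure lborel (\<Union>n. A \<inter> {-real n..real n})"
      using that by (intro Lim_emeasure_incseq) (auto simp: incseq_def)
    ultimately show ?thesis by simp
  qed
  have "\<forall>\<^sub>F n in sequentially. 0 < emeasure lborel (A1 \<inter> {-real n..real n})"
    "\<forall>\<^sub>F n in sequentially. 0 < emeasure lborel (A2 \<inter> {-real n..real n})"
    by - (rule order_tendstoD(1)[OF lim]; use pos in simp)+
  then have "\<forall>\<^sub>F n in sequentially. emeasure lborel (A1 \<inter> {-real n..real n}) + emeasure lborel (A2 \<inter> {-real n..real n}) \<le> emeasure lborel B"
  proof eventually_elim
    case (elim n)
    have "AE v in lborel. v \<in> A1 \<inter> {-real n..real n} \<longrightarrow> (AE u in lborel. u \<in> A2 \<inter> {-real n..real n} \<longrightarrow> v + u \<in> B)"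
      using ae by eventually_elim (auto elim!: eventually_mono)
    then show ?case by (rule emeasure_sum_set_bounded[rotated 3]) (use elim in auto)
  qed
  moreover have "(\<lambda>n. emeasure lborel (A1 \<inter> {-real n..real n}) + emeasure lborel (A2 \<inter> {-real n..real n})) \<longlonglongrightarrow> emeasure lborel A1 + emeasure lborel A2"
    by (intro tendsto_add lim) auto
  ultimately show ?thesis by (intro tendsto_upperbound[OF _ _ sequentially_bot])
qed

section \<open>Null sets of product measures and sums of several sets\<close>

interpretation lborel_PiM: product_sigma_finite "\<lambda>_. lborel :: 'a::euclidean_space measure"
  by standard

text \<open>Fubini for null sets, in both orders of integration. No measurability of
  \<open>P\<close> is assumed, so a measurable null set \<open>S\<close> containing all its
  exceptions is sliced instead.\<close>

lemma AE_PiM_insert: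
  fixes P :: "('i \<Rightarrow> 'a::euclidean_space) \<Rightarrow> bool"
  assumes I: "finite I" "j \<notin> I" and ae: "AE x in PiM (insert j I) (\<lambda>_. lborel). P x"
  shows "AE v in PiM I (\<lambda>_. lborel). AE u in lborel. P (v(j := u))"
    and "AE u in lborel. AE v in PiM I (\<lambda>_. lborel). P (v(j := u))"
proof -
  let ?M = "PiM (insert j I) (\<lambda>_. lborel :: 'a measure)" and ?N = "PiM I (\<lambda>_. lborel :: 'a measure)"
  interpret N: sigma_finite_measure ?N by (rule lborel_PiM.sigma_finite) fact
  obtain S where S: "\<And>x. x \<in> space ?M - S \<Longrightarrow> P x" and S0: "S \<in> null_sets ?M"
    using AE_E3[OF ae] by blast
  have [measurable]: "S \<in> sets ?M" using S0 by auto
  have 0: "integral\<^sup>N ?M (indicator S) = 0" using S0 by auto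
  have upd: "v(j := u) \<in> space ?M" if "v \<in> space ?N" for v and u :: 'a
    using that by (auto simp: space_PiM PiE_def extensional_def)
  have "AE v in ?N. AE u in lborel. indicator S (v(j := u)) = (0::ennreal)"
    using 0 unfolding lborel_PiM.product_nn_integral_insert[OF I borel_measurable_indicator[OF \<open>S \<in> sets ?M\<close>]]
    by (subst (asm) nn_integral_0_iff_AE, measurable) (auto elim!: eventually_mono simp: nn_integral_0_iff_AE)
  then show "AE v in ?N. AE u in lborel. P (v(j := u))"
    using AE_space by eventually_elim (auto elim!: eventually_mono intro!: S upd split: split_indicator_asm)
  have "AE u in lborel. AE v in ?N. indicator S (v(j := u)) = (0::ennreal)"
    using 0 unfolding lborel_PiM.product_nn_integral_insert_rev[OF I borel_measurable_indicator[OF \<open>S \<in> sets ?M\<close>]]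
    by (subst (asm) nn_integral_0_iff_AE, measurable) (auto elim!: eventually_mono simp: nn_integral_0_iff_AE)
  then show "AE u in lborel. AE v in ?N. P (v(j := u))"
  proof eventually_elim
    case (elim u)
    then show ?case using AE_space by eventually_elim (auto intro!: S upd split: split_indicator_asm)
  qed
qed

text \<open>Induction on the number of summands. For the partial sums the target becomes
  \<open>B'\<close>, the set of points v from which almost every step \<open>b j * u\<close> with u
  in \<open>A j\<close> lands in B.\<close>

lemma emeasure_sum_sets:
  fixes A :: "'i \<Rightarrow> real set" and b :: "'i \<Rightarrow> real"
  assumes "finite J" "\<And>i. i \<in> J \<Longrightarrow> b i \<noteq> 0" "\<And>i. i \<in> J \<Longrightarrow> A i \<in> sets borel"
    "\<And>i. i \<in> J \<Longrightarrow> 0 < emeasure lborel (A i)" "B \<in> sets borel"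
    "AE s in PiM J (\<lambda>_. lborel). (\<forall>i\<in>J. s i \<in> A i) \<longrightarrow> (\<Sum>i\<in>J. b i * s i) \<in> B"
  shows "(\<Sum>i\<in>J. ennreal \<bar>b i\<bar> * emeasure lborel (A i)) \<le> emeasure lborel B"
  using assms
proof (induction J arbitrary: B rule: finite_induct)
  case empty
  then show ?case by simp
next
  case (insert j J)
  have bj: "b j \<noteq> 0" and [measurable]: "A j \<in> sets borel" "B \<in> sets borel" using insert.prems by auto
  define B' where "B' = {v. AE u in lborel. u \<in> A j \<longrightarrow> v + b j * u \<in> B}"
  have "B' = {v. (\<integral>\<^sup>+u. indicator (A j) u * indicator (- B) (v + b j * u) \<partial>lborel) = 0}"
    unfolding B'_def
    by (subst nn_integral_0_iff_AE) (auto simp: indicator_def intro!: Collect_cong AE_cong)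
  also have "\<dots> \<in> sets borel" by measurable
  finally have [measurable]: "B' \<in> sets borel" .
  have "AE s in PiM J (\<lambda>_. lborel). AE u in lborel. (\<forall>i\<in>insert j J. (s(j := u)) i \<in> A i)
      \<longrightarrow> (\<Sum>i\<in>insert j J. b i * (s(j := u)) i) \<in> B"
    by (rule AE_PiM_insert(1)[OF _ _ insert.prems(5)]) (use insert.hyps in auto)
  then have ae: "AE s in PiM J (\<lambda>_. lborel). (\<forall>i\<in>J. s i \<in> A i) \<longrightarrow> (\<Sum>i\<in>J. b i * s i) \<in> B'"
  proof eventually_elim
    case (elim s)
    have "(\<Sum>i\<in>insert j J. b i * (s(j := u)) i) = (\<Sum>i\<in>J. b i * s i) + b j * u" for u
      using insert.hyps by (simp add: add_ac) (intro sum.cong, auto)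
    moreover have "(\<forall>i\<in>insert j J. (s(j := u)) i \<in> A i) \<longleftrightarrow> u \<in> A j \<and> (\<forall>i\<in>J. s i \<in> A i)" for u
      using insert.hyps by auto
    ultimately show ?case
      using elim unfolding B'_def by (auto elim!: eventually_mono)
  qed
  have IH: "(\<Sum>i\<in>J. ennreal \<bar>b i\<bar> * emeasure lborel (A i)) \<le> emeasure lborel B'"
    by (rule insert.IH) (use insert.prems ae in auto)
  define A2 where "A2 = {u. u / b j \<in> A j}"
  have [measurable]: "A2 \<in> sets borel" unfolding A2_def by measurable
  have eA2: "emeasure lborel A2 = ennreal \<bar>b j\<bar> * emeasure lborel (A j)"
    using nn_integral_real_affine[of "indicator A2" "b j" 0] bj
    by (simp add: A2_def nn_integral_indicator[symmetric] indicator_def)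
  have A2: "AE u in lborel. u \<in> A2 \<longrightarrow> v + u \<in> B" if "v \<in> B'" for v
  proof -
    have "AE u in lborel. u \<in> A j \<longrightarrow> v + b j * u \<in> B" using that by (simp add: B'_def)
    then have "AE u in lborel. (0 + (1 / b j) * u) \<in> A j \<longrightarrow> v + b j * (0 + (1 / b j) * u) \<in> B"
      using bj by (intro AE_borel_affine) auto
    then show ?thesis using bj by (simp add: A2_def)
  qed
  \<comment> \<open>The two-set inequality asks for non-null sets, and \<open>B'\<close> can be null
    only if J is empty. The partial sum is then 0, and 0 \<in> \<open>B'\<close> says that B
    contains almost all of \<open>A2\<close>.\<close>
  have B'A2: "emeasure lborel B' + emeasure lborel A2 \<le> emeasure lborel B"
  proof (cases "emeasure lborel B' = 0")
    case True
    have "J = {}"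
    proof (rule ccontr)
      assume "J \<noteq> {}"
      then obtain i where i: "i \<in> J" by auto
      have "ennreal \<bar>b i\<bar> * emeasure lborel (A i) = 0"
        using IH True i insert.hyps(1) by (simp add: sum_nonneg_eq_0_iff)
      then show False using insert.prems(1,3)[of i] i by simp
    qed
    then have "0 \<in> B'" using ae unfolding \<open>J = {}\<close> PiM_empty by (simp add: AE_count_space)
    then have "AE u in lborel. u \<in> A2 \<longrightarrow> u \<in> B" using A2[of 0] by simp
    then show ?thesis using True by (simp add: emeasure_mono_AE)
  next
    case False
    have "0 < emeasure lborel A2"
      using insert.prems(3)[of j] bj unfolding \<open>emeasure lborel A2 = _\<close> by (simp add: ennreal_zero_less_mult_iff)
    then show ?thesis using False A2 by (intro emeasure_sum_set) (auto simp: zero_less_iff_neq_zero)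
  qed
  have "(\<Sum>i\<in>insert j J. ennreal \<bar>b i\<bar> * emeasure lborel (A i)) \<le> emeasure lborel A2 + emeasure lborel B'"
    using insert.hyps IH by (simp add: add_left_mono eA2)
  also have "\<dots> \<le> emeasure lborel B" using B'A2 by (simp add: add.commute)
  finally show ?case .
qed

section \<open>The inequality in dimension one\<close>

text \<open>The layer cake formula cut off at level k. The level is rescaled so that functions with
  different cut-offs are integrated over the same range 0 < s < 1.\<close>

lemma nn_integral_min_layer_cake:
  fixes X :: "'a \<Rightarrow> real"
  assumes M: "sigma_finite_measure M" and [measurable]: "X \<in> borel_measurable M"
    and X: "\<And>x. 0 \<le> X x" and k: "0 < k"
  shows "(\<integral>\<^sup>+x. ennreal (min (X x) k) \<partial>M)
    = ennreal k * (\<integral>\<^sup>+s. indicator {0<..<1} s * emeasure M {x\<in>space M. k * s \<le> X x} \<partial>lborel)"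
proof -
  interpret M: sigma_finite_measure M by fact
  interpret P: pair_sigma_finite M "lborel :: real measure" ..
  let ?I = "\<lambda>x s. indicator {0<..<1} s * indicator {x\<in>space M. k * s \<le> X x} x :: ennreal"
  have "(\<integral>\<^sup>+s. indicator {0<..<1} s * emeasure M {x\<in>space M. k * s \<le> X x} \<partial>lborel)
      = (\<integral>\<^sup>+s. \<integral>\<^sup>+x. ?I x s \<partial>M \<partial>lborel)"
    by (simp add: nn_integral_cmult)
  also have "\<dots> = (\<integral>\<^sup>+x. \<integral>\<^sup>+s. ?I x s \<partial>lborel \<partial>M)"
    by (intro P.Fubini') measurable
  also have "\<dots> = (\<integral>\<^sup>+x. ennreal (min (X x) k / k) \<partial>M)"
  proof (intro nn_integral_cong)
    fix x assume x: "x \<in> space M"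
    have "(\<integral>\<^sup>+s. ?I x s \<partial>lborel) = (\<integral>\<^sup>+s. indicator ({0<..<1} \<inter> {..X x / k}) s \<partial>lborel)"
      using k x by (intro nn_integral_cong) (auto simp: indicator_def field_simps)
    also have "\<dots> = emeasure lborel ({0<..<1} \<inter> {..X x / k})" by simp
    also have "\<dots> = ennreal (min (X x) k / k)"
    proof (cases "X x < k")
      case True
      then have "X x / k < 1" using k by simp
      then have "{0<..<1} \<inter> {..X x / k} = {0<..X x / k}" by auto
      with True k X[of x] show ?thesis by simp
    next
      case False
      then have "1 \<le> X x / k" using k by simp
      then have "{0<..<1} \<inter> {..X x / k} = {0<..<1}" by auto
      with False k show ?thesis by simp
    qed
    finally show "(\<integral>\<^sup>+s. ?I x s \<partial>lborel) = ennreal (min (X x) k / k)" .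
  qed
  finally have "ennreal k * (\<integral>\<^sup>+s. indicator {0<..<1} s * emeasure M {x\<in>space M. k * s \<le> X x} \<partial>lborel)
      = (\<integral>\<^sup>+x. ennreal k * ennreal (min (X x) k / k) \<partial>M)"
    by (simp add: nn_integral_cmult)
  also have "\<dots> = (\<integral>\<^sup>+x. ennreal (min (X x) k) \<partial>M)"
    using k X by (intro nn_integral_cong) (simp flip: ennreal_mult'')
  finally show ?thesis by simp
qed

text \<open>The level must be low enough to be reached on a set of positive measure, yet high enough
  to keep the fraction r of the integral. A large n achieves the latter; from there the level is
  lowered by factors r until it is reached for the first time.\<close>

lemma ex_truncation_level:
  fixes F :: "'a \<Rightarrow> real"
  assumes [measurable]: "F \<in> borel_measurable M" and F: "\<And>x. 0 \<le> F x"
    and I: "0 < (\<integral>\<^sup>+x. F x \<partial>M)" "(\<integral>\<^sup>+x. F x \<partial>M) < \<infinity>" and r: "0 < r" "r < 1"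
  shows "\<exists>\<sigma>>0. 0 < emeasure M {x\<in>space M. \<sigma> \<le> F x} \<and>
    ennreal r * (\<integral>\<^sup>+x. F x \<partial>M) \<le> (\<integral>\<^sup>+x. ennreal (min (F x) \<sigma>) \<partial>M)"
proof -
  let ?I = "\<integral>\<^sup>+x. F x \<partial>M"
  have "(SUP n. \<integral>\<^sup>+x. ennreal (min (F x) (real n)) \<partial>M) = (\<integral>\<^sup>+x. (SUP n. ennreal (min (F x) (real n))) \<partial>M)"
    by (intro nn_integral_monotone_convergence_SUP[symmetric])
      (auto simp: incseq_def le_fun_def intro!: ennreal_leI)
  also have "(\<lambda>x. SUP n. ennreal (min (F x) (real n))) = (\<lambda>x. ennreal (F x))"
  proof
    fix x
    obtain n where "F x \<le> real n" using real_arch_simple by blast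
    then have "ennreal (F x) \<le> ennreal (min (F x) (real n))" by (simp add: min_def)
    then show "(SUP n. ennreal (min (F x) (real n))) = ennreal (F x)"
      by (intro antisym SUP_least) (auto intro: ennreal_leI SUP_upper2)
  qed
  finally have sup: "(SUP n. \<integral>\<^sup>+x. ennreal (min (F x) (real n)) \<partial>M) = ?I" .
  have "ennreal r * ?I < ?I"
    using I r by (cases "?I" rule: ennreal_cases) (auto simp: ennreal_mult[symmetric] intro!: ennreal_lessI)
  then obtain n where n: "ennreal r * ?I < (\<integral>\<^sup>+x. ennreal (min (F x) (real n)) \<partial>M)"
    unfolding sup[symmetric] less_SUP_iff by auto
  have "min (F x) 0 = 0" for x using F[of x] by simp
  then have n0: "0 < real n" using n by (cases "n = 0") auto
  let ?P = "\<lambda>k::nat. 0 < emeasure M {x\<in>space M. n * r ^ k \<le> F x}"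
  have "\<exists>k. ?P k"
  proof (rule ccontr)
    assume "\<not> ?thesis"
    then have "AE x in M. \<forall>k. \<not> n * r ^ k \<le> F x"
      unfolding AE_all_countable by (subst AE_iff_measurable[OF _ refl]) (auto simp: not_less)
    then have "AE x in M. F x = 0"
    proof eventually_elim
      case (elim x)
      have "(\<lambda>k. n * r ^ k) \<longlonglongrightarrow> real n * 0" using r by (intro tendsto_intros LIMSEQ_power_zero) auto
      then have "F x \<le> real n * 0" by (rule LIMSEQ_le_const) (use elim in \<open>auto simp: not_le less_imp_le\<close>)
      then show ?case using F[of x] by simp
    qed
    then have "?I = 0" by (subst nn_integral_0_iff_AE) auto
    then show False using I by simp
  qed
  define k where "k = (LEAST k. ?P k)"
  have k: "?P k" and least: "\<And>j. j < k \<Longrightarrow> \<not> ?P j"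
    unfolding k_def using \<open>\<exists>k. ?P k\<close> by (auto intro: LeastI_ex dest: not_less_Least)
  show ?thesis
  proof (intro exI[of _ "n * r ^ k"] conjI)
    show "ennreal r * ?I \<le> (\<integral>\<^sup>+x. ennreal (min (F x) (n * r ^ k)) \<partial>M)"
    proof (cases k)
      case 0
      then show ?thesis using n by (simp add: less_imp_le)
    next
      case (Suc j)
      \<comment> \<open>The previous level is almost nowhere reached, so r F lies below the new
        level as well as below F.\<close>
      have "AE x in M. \<not> n * r ^ j \<le> F x"
        using least[of j] Suc by (subst AE_iff_measurable[OF _ refl]) (auto simp: not_less)
      then have "AE x in M. ennreal (r * F x) \<le> ennreal (min (F x) (n * r ^ k))"
      proof eventually_elim
        case (elim x)
        have "r * F x \<le> F x" using F[of x] r by (simp add: mult_left_le_one_le)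
        moreover have "r * F x \<le> r * (n * r ^ j)" using elim r by (intro mult_left_mono) auto
        ultimately show ?case by (intro ennreal_leI) (simp add: Suc mult_ac)
      qed
      then have "(\<integral>\<^sup>+x. ennreal (r * F x) \<partial>M) \<le> (\<integral>\<^sup>+x. ennreal (min (F x) (n * r ^ k)) \<partial>M)"
        by (rule nn_integral_mono_AE)
      then show ?thesis using r by (simp add: ennreal_mult' nn_integral_cmult)
    qed
  qed (use k n0 r in auto)
qed

text \<open>\<open>R\<close> collects what is known about the point z only up to a null set; in the
  induction on the dimension it says that the slices at z are well behaved.\<close>

lemma Borell_Brascamp_Lieb_real:
  fixes F G :: "'m::finite \<Rightarrow> real \<Rightarrow> real"
  assumes w: "is_weight w" and p: "p \<le> 1" and b: "\<And>i. b $ i \<noteq> 0" and c: "0 < c"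
    and F[measurable]: "\<And>i. F i \<in> borel_measurable borel" "\<And>i x. 0 \<le> F i x"
    and G[measurable]: "\<And>i. G i \<in> borel_measurable borel" "\<And>i x. 0 \<le> G i x"
    and intF: "\<And>i. 0 < (\<integral>\<^sup>+x. F i x \<partial>lborel)" "\<And>i. (\<integral>\<^sup>+x. F i x \<partial>lborel) < \<infinity>"
    and intG: "\<And>i. (\<integral>\<^sup>+x. G i x \<partial>lborel) < \<infinity>"
    and R: "AE z in lborel. R z"
    and ae: "AE s in PiM UNIV (\<lambda>_. lborel). (\<forall>i. 0 < F i (s i)) \<longrightarrow> R (\<Sum>i\<in>UNIV. b $ i * s i) \<longrightarrow>
      c \<le> power_mean w p (\<chi> i. G i (\<Sum>i\<in>UNIV. b $ i * s i) / F i (s i))"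
  shows "c \<le> power_mean w (power_transform 1 p)
    (\<chi> i. w $ i / \<bar>b $ i\<bar> * (enn2real (\<integral>\<^sup>+x. G i x \<partial>lborel) / enn2real (\<integral>\<^sup>+x. F i x \<partial>lborel)))"
    (is "c \<le> ?Mq")
proof -
  define IF where "IF i = enn2real (\<integral>\<^sup>+x. F i x \<partial>lborel)" for i
  define IG where "IG i = enn2real (\<integral>\<^sup>+x. G i x \<partial>lborel)" for i
  have IF: "ennreal (IF i) = (\<integral>\<^sup>+x. F i x \<partial>lborel)" and IG: "ennreal (IG i) = (\<integral>\<^sup>+x. G i x \<partial>lborel)" for i
    using intF(2)[of i] intG[of i] by (simp_all add: IF_def IG_def)
  have IF0: "0 < IF i" and IG0: "0 \<le> IG i" for i
    using intF[of i] by (auto simp: IF_def IG_def enn2real_positive_iff)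
  define a where "a = (\<chi> i. w $ i / \<bar>b $ i\<bar> * (IG i / IF i))"
  have wp: "0 < w $ i" for i by (rule weightD(1)[OF w])
  have a0: "0 \<le> a $ i" for i using wp[of i] b[of i] IF0[of i] IG0[of i] by (simp add: a_def)
  have aG: "IG i = 0" if "a $ i = 0" for i using that wp[of i] b[of i] IF0[of i] by (simp add: a_def)
  define MQ where "MQ = power_mean w (power_transform 1 p) a"
  have MQ0: "0 \<le> MQ" unfolding MQ_def by (intro power_mean_nonneg a0)
  have main: "r * c \<le> MQ" if r: "0 < r" "r < 1" for r
  proof -
    have "\<forall>i. \<exists>\<sigma>>0. 0 < emeasure lborel {x\<in>space lborel. \<sigma> \<le> F i x} \<and>
        ennreal r * (\<integral>\<^sup>+x. F i x \<partial>lborel) \<le> (\<integral>\<^sup>+x. ennreal (min (F i x) \<sigma>) \<partial>lborel)"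
      by (intro allI ex_truncation_level) (use F intF r in auto)
    then obtain \<sigma> where \<sigma>: "\<And>i. 0 < \<sigma> i" "\<And>i. 0 < emeasure lborel {x. \<sigma> i \<le> F i x}"
      and trunc: "\<And>i. ennreal r * ennreal (IF i) \<le> (\<integral>\<^sup>+x. ennreal (min (F i x) (\<sigma> i)) \<partial>lborel)"
      by (auto simp: choice_iff IF)
    define h where "h z = power_mean w p (\<chi> i. G i z / \<sigma> i)" for z
    have [measurable]: "h \<in> borel_measurable borel"
      unfolding h_def[abs_def] by (rule borel_measurable_power_mean) simp
    have h0: "0 \<le> h z" for z
      unfolding h_def by (intro power_mean_nonneg) (use G(2) \<sigma>(1) in \<open>simp add: less_imp_le\<close>)
    \<comment> \<open>On the superlevel sets the denominators are at least
      \<open>\<sigma> i * s\<close>, and homogeneity of the power mean pulls out the factor 1 /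
      s.\<close>
    have level: "(\<Sum>i\<in>UNIV. ennreal \<bar>b $ i\<bar> * emeasure lborel {x. \<sigma> i * s \<le> F i x}) \<le> emeasure lborel {z. c * s \<le> h z}"
      if s: "0 < s" "s < 1" for s
    proof -
      obtain N where N: "\<And>z. z \<in> space lborel - N \<Longrightarrow> R z" "N \<in> null_sets lborel"
        using AE_E3[OF R] by blast
      have [measurable]: "N \<in> sets borel" using N(2) by auto
      \<comment> \<open>Nothing is known about weighted sums at which \<open>R\<close> fails, so the
        null set \<open>N\<close> of such points joins the target.\<close>
      have "(\<Sum>i\<in>UNIV. ennreal \<bar>b $ i\<bar> * emeasure lborel {x. \<sigma> i * s \<le> F i x}) \<le> emeasure lborel ({z. c * s \<le> h z} \<union> N)"
      proof (rule emeasure_sum_sets)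
        show "0 < emeasure lborel {x. \<sigma> i * s \<le> F i x}" for i
        proof -
          have "\<sigma> i * s \<le> \<sigma> i" using \<sigma>(1)[of i] s by simp
          then have "emeasure lborel {x. \<sigma> i \<le> F i x} \<le> emeasure lborel {x. \<sigma> i * s \<le> F i x}"
            by (intro emeasure_mono) auto
          then show ?thesis using \<sigma>(2)[of i] by (rule order_less_le_trans[rotated])
        qed
        show "AE t in PiM UNIV (\<lambda>_. lborel). (\<forall>i\<in>UNIV. t i \<in> {x. \<sigma> i * s \<le> F i x}) \<longrightarrow>
            (\<Sum>i\<in>UNIV. b $ i * t i) \<in> {z. c * s \<le> h z} \<union> N"
          using ae
        proof eventually_elim
          case (elim t)
          let ?z = "\<Sum>i\<in>UNIV. b $ i * t i"
          show ?case
          proof (intro impI)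
            assume t: "\<forall>i\<in>UNIV. t i \<in> {x. \<sigma> i * s \<le> F i x}"
            have Fp: "0 < F i (t i)" for i
              using t s \<sigma>(1)[of i] by (auto intro: less_le_trans[of 0 "\<sigma> i * s"])
            show "?z \<in> {z. c * s \<le> h z} \<union> N"
            proof (cases "?z \<in> N")
              case False
              then have "c \<le> power_mean w p (\<chi> i. G i ?z / F i (t i))" using elim Fp N(1)[of ?z] by simp
              also have "\<dots> \<le> power_mean w p ((1 / s) *\<^sub>R (\<chi> i. G i ?z / \<sigma> i))"
              proof (intro power_mean_mono w)
                fix i
                have "G i ?z / F i (t i) \<le> G i ?z / (\<sigma> i * s)"
                  using t s \<sigma>(1)[of i] Fp[of i] G(2) by (intro divide_left_mono) auto
                then show "(\<chi> i. G i ?z / F i (t i)) $ i \<le> ((1 / s) *\<^sub>R (\<chi> i. G i ?z / \<sigma> i)) $ i"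
                  by (simp add: mult.commute)
              qed (use Fp G(2) in \<open>simp add: less_imp_le\<close>)
              also have "\<dots> = (1 / s) * h ?z"
                unfolding h_def by (intro power_mean_scale w) (use s \<sigma>(1) G(2) in \<open>auto simp: less_imp_le\<close>)
              finally show ?thesis using s by (simp add: field_simps)
            qed simp
          qed
        qed
      qed (use b in auto)
      also have "\<dots> = emeasure lborel {z. c * s \<le> h z}"
        using N(2) by (intro emeasure_Un_null_set) auto
      finally show ?thesis .
    qed
    define T where "T = (\<Sum>i\<in>UNIV. \<bar>b $ i\<bar> * IF i / \<sigma> i)"
    have T: "0 < T" unfolding T_def by (intro sum_pos divide_pos_pos mult_pos_pos) (use b IF0 \<sigma> in auto)
    have "ennreal (r * T) = (\<Sum>i\<in>UNIV. ennreal (\<bar>b $ i\<bar> / \<sigma> i) * (ennreal r * ennreal (IF i)))"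
      unfolding T_def sum_distrib_left using \<sigma>(1) IF0 r
      by (subst sum_ennreal[symmetric]) (auto simp: less_imp_le ennreal_mult[symmetric] mult_ac intro!: sum.cong)
    also have "\<dots> \<le> (\<Sum>i\<in>UNIV. ennreal (\<bar>b $ i\<bar> / \<sigma> i) * (\<integral>\<^sup>+x. ennreal (min (F i x) (\<sigma> i)) \<partial>lborel))"
      by (intro sum_mono mult_left_mono trunc) auto
    also have "\<dots> = (\<Sum>i\<in>UNIV. ennreal \<bar>b $ i\<bar> * (\<integral>\<^sup>+s. indicator {0<..<1} s * emeasure lborel {x\<in>space lborel. \<sigma> i * s \<le> F i x} \<partial>lborel))"
    proof (intro sum.cong refl)
      fix i
      have "ennreal (\<bar>b $ i\<bar> / \<sigma> i) * ennreal (\<sigma> i) = ennreal \<bar>b $ i\<bar>"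
        using \<sigma>(1)[of i] by (simp flip: ennreal_mult'')
      then show "ennreal (\<bar>b $ i\<bar> / \<sigma> i) * (\<integral>\<^sup>+x. ennreal (min (F i x) (\<sigma> i)) \<partial>lborel)
          = ennreal \<bar>b $ i\<bar> * (\<integral>\<^sup>+s. indicator {0<..<1} s * emeasure lborel {x\<in>space lborel. \<sigma> i * s \<le> F i x} \<partial>lborel)"
        by (subst nn_integral_min_layer_cake[OF sigma_finite_lborel]) (use F \<sigma> in \<open>auto simp flip: mult.assoc\<close>)
    qed
    also have "\<dots> = (\<integral>\<^sup>+s. indicator {0<..<1} s * (\<Sum>i\<in>UNIV. ennreal \<bar>b $ i\<bar> * emeasure lborel {x. \<sigma> i * s \<le> F i x}) \<partial>lborel)"
      by (simp add: nn_integral_sum[symmetric] nn_integral_cmult[symmetric] sum_distrib_left mult_ac)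
    also have "\<dots> \<le> (\<integral>\<^sup>+s. indicator {0<..<1} s * emeasure lborel {z. c * s \<le> h z} \<partial>lborel)"
      by (intro nn_integral_mono) (auto simp: indicator_def intro: level)
    finally have "ennreal c * ennreal (r * T) \<le> ennreal c * (\<integral>\<^sup>+s. indicator {0<..<1} s * emeasure lborel {z. c * s \<le> h z} \<partial>lborel)"
      by (rule mult_left_mono) simp
    also have "\<dots> = (\<integral>\<^sup>+z. ennreal (min (h z) c) \<partial>lborel)"
      by (subst nn_integral_min_layer_cake[OF sigma_finite_lborel]) (use h0 c in auto)
    also have "\<dots> \<le> (\<integral>\<^sup>+z. ennreal (MQ * (\<Sum>i\<in>UNIV. w $ i / (\<sigma> i * a $ i) * G i z)) \<partial>lborel)"
    proof (rule nn_integral_mono_AE)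
      \<comment> \<open>Where \<open>a $ i\<close> is 0 the integral of \<open>G i\<close> vanishes.
        Hence the condition of Hoelder's inequality on the zeros of \<open>a\<close> holds at almost
        every z.\<close>
      have "AE z in lborel. a $ i = 0 \<longrightarrow> G i z = 0" for i
      proof (cases "a $ i = 0")
        case True
        then have "(\<integral>\<^sup>+z. G i z \<partial>lborel) = 0" using aG[of i] IG[of i] by simp
        then have "AE z in lborel. ennreal (G i z) = 0" by (subst (asm) nn_integral_0_iff_AE) auto
        then show ?thesis by eventually_elim (use G(2) in \<open>auto simp: antisym\<close>)
      qed simp
      then have "AE z in lborel. \<forall>i. a $ i = 0 \<longrightarrow> G i z = 0" by (simp add: AE_all_countable)
      then show "AE z in lborel. ennreal (min (h z) c) \<le> ennreal (MQ * (\<Sum>i\<in>UNIV. w $ i / (\<sigma> i * a $ i) * G i z))"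
      proof eventually_elim
        case (elim z)
        have "h z \<le> MQ * (\<Sum>i\<in>UNIV. w $ i * ((\<chi> i. G i z / \<sigma> i) $ i / a $ i))"
          unfolding h_def MQ_def
          by (intro power_mean_Hoelder w p a0) (use elim G(2) \<sigma>(1) in \<open>auto simp: less_imp_le\<close>)
        also have "\<dots> = MQ * (\<Sum>i\<in>UNIV. w $ i / (\<sigma> i * a $ i) * G i z)" by (simp add: field_simps)
        finally show ?case by (intro ennreal_leI) simp
      qed
    qed
    also have "\<dots> = ennreal MQ * (\<Sum>i\<in>UNIV. ennreal (w $ i / (\<sigma> i * a $ i)) * ennreal (IG i))"
    proof -
      have "(\<integral>\<^sup>+z. ennreal (MQ * (\<Sum>i\<in>UNIV. w $ i / (\<sigma> i * a $ i) * G i z)) \<partial>lborel)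
        = (\<integral>\<^sup>+z. ennreal MQ * (\<Sum>i\<in>UNIV. ennreal (w $ i / (\<sigma> i * a $ i)) * ennreal (G i z)) \<partial>lborel)"
        using MQ0 wp \<sigma>(1) a0 G(2)
        by (intro nn_integral_cong) (auto simp: ennreal_mult'[symmetric] ennreal_mult''[symmetric] less_imp_le sum_ennreal intro!: sum_nonneg arg_cong[where f="\<lambda>x. ennreal (MQ * x)"])
      also have "\<dots> = ennreal MQ * (\<Sum>i\<in>UNIV. ennreal (w $ i / (\<sigma> i * a $ i)) * ennreal (IG i))"
        by (simp add: nn_integral_cmult nn_integral_sum IG)
      finally show ?thesis .
    qed
    also have "\<dots> = ennreal (MQ * (\<Sum>i\<in>UNIV. w $ i / (\<sigma> i * a $ i) * IG i))"
      using MQ0 wp \<sigma>(1) a0 IG0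
      by (auto simp: ennreal_mult'[symmetric] ennreal_mult''[symmetric] less_imp_le sum_ennreal)
    also have "\<dots> \<le> ennreal (MQ * T)"
    proof (intro ennreal_leI mult_left_mono MQ0)
      \<comment> \<open>The terms agree by the choice of \<open>a\<close> if \<open>IG i\<close> is
        positive; otherwise the term on the left is 0.\<close>
      show "(\<Sum>i\<in>UNIV. w $ i / (\<sigma> i * a $ i) * IG i) \<le> T"
        unfolding T_def
      proof (intro sum_mono)
        fix i
        show "w $ i / (\<sigma> i * a $ i) * IG i \<le> \<bar>b $ i\<bar> * IF i / \<sigma> i"
          using wp[of i] \<sigma>(1)[of i] IF0[of i] b[of i] by (cases "IG i = 0") (auto simp: a_def field_simps)
      qed
    qed
    finally have "ennreal (c * (r * T)) \<le> ennreal (MQ * T)" using c r T by (simp add: ennreal_mult')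
    then have "c * (r * T) \<le> MQ * T" using MQ0 T by (subst (asm) ennreal_le_iff) auto
    then show ?thesis using T by (simp add: mult_ac)
  qed
  have "((\<lambda>r. r * c) \<longlongrightarrow> 1 * c) (at_left 1)" by (intro tendsto_intros)
  moreover have "\<forall>\<^sub>F r in at_left (1::real). r * c \<le> MQ"
    using eventually_at_left_real[of 0 1] by (auto elim!: eventually_mono intro: main)
  ultimately have "1 * c \<le> MQ" by (rule tendsto_upperbound) simp
  then show ?thesis by (simp add: MQ_def a_def IF_def IG_def)
qed

section \<open>Induction on the dimension\<close>

lemma AE_PiM_Un:
  fixes P :: "('i \<Rightarrow> 'a::euclidean_space) \<Rightarrow> bool"
  assumes "I \<inter> J = {}" "finite I" "finite J" and ae: "AE x in PiM (I \<union> J) (\<lambda>_. lborel). P x"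
  shows "AE x in PiM I (\<lambda>_. lborel). AE y in PiM J (\<lambda>_. lborel). P (merge I J (x, y))"
proof -
  let ?M = "\<lambda>I. PiM I (\<lambda>_. lborel :: 'a measure)"
  interpret pair_sigma_finite "?M I" "?M J"
    using assms by (intro pair_sigma_finite.intro lborel_PiM.sigma_finite)
  have "AE x in distr (?M I \<Otimes>\<^sub>M ?M J) (?M (I \<union> J)) (merge I J). P x"
    unfolding lborel_PiM.distr_merge[OF assms(1-3)] by (rule ae)
  then have "AE x in ?M I \<Otimes>\<^sub>M ?M J. P (merge I J x)" by (rule AE_distrD[OF measurable_merge])
  then show ?thesis by (rule AE_pair)
qed

text \<open>An injective relabelling of the factors pushes the product measure to the product
  measure, as is seen on product sets. It turns the product over \<open>UNIV \<times> {j}\<close>,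
  the j-th coordinates of all vectors, into one over \<open>UNIV\<close>.\<close>

lemma AE_PiM_reindex:
  fixes P :: "('i \<Rightarrow> 'a::euclidean_space) \<Rightarrow> bool"
  assumes I: "finite I" "inj_on t I" and ae: "AE x in PiM I (\<lambda>_. lborel). P x"
  shows "AE s in PiM (t ` I) (\<lambda>_. lborel). P (\<lambda>i\<in>I. s (t i))"
proof -
  let ?M = "\<lambda>I. PiM I (\<lambda>_. lborel :: 'a measure)"
  have [measurable]: "(\<lambda>s. \<lambda>i\<in>I. s (t i)) \<in> measurable (PiM (t ` I) (\<lambda>_. lborel :: 'a measure)) (?M I)"
    by (intro measurable_restrict measurable_component_singleton) auto
  have eq: "distr (PiM (t ` I) (\<lambda>_. lborel)) (?M I) (\<lambda>s. \<lambda>i\<in>I. s (t i)) = ?M I"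
  proof (rule lborel_PiM.PiM_eqI)
    fix A :: "'i \<Rightarrow> 'a set" assume A: "\<And>i. i \<in> I \<Longrightarrow> A i \<in> sets lborel"
    have "emeasure (distr (PiM (t ` I) (\<lambda>_. lborel)) (?M I) (\<lambda>s. \<lambda>i\<in>I. s (t i))) (Pi\<^sub>E I A)
        = emeasure (PiM (t ` I) (\<lambda>_. lborel)) ((\<lambda>s. \<lambda>i\<in>I. s (t i)) -` Pi\<^sub>E I A \<inter> space (PiM (t ` I) (\<lambda>_. lborel :: 'a measure)))"
      by (intro emeasure_distr) (use A I in \<open>auto intro!: sets_PiM_I_finite\<close>)
    also have "(\<lambda>s. \<lambda>i\<in>I. s (t i)) -` Pi\<^sub>E I A \<inter> space (PiM (t ` I) (\<lambda>_. lborel :: 'a measure))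
        = Pi\<^sub>E (t ` I) (\<lambda>k. A (the_inv_into I t k))"
      using I by (auto simp: space_PiM PiE_iff the_inv_into_f_f)
    also have "emeasure (PiM (t ` I) (\<lambda>_. lborel)) \<dots> = (\<Prod>k\<in>t ` I. emeasure lborel (A (the_inv_into I t k)))"
      using I A by (intro lborel_PiM.emeasure_PiM) (auto simp: the_inv_into_f_f)
    also have "\<dots> = (\<Prod>i\<in>I. emeasure lborel (A i))"
      using I by (subst prod.reindex) (auto simp: the_inv_into_f_f)
    finally show "emeasure (distr (PiM (t ` I) (\<lambda>_. lborel)) (?M I) (\<lambda>s. \<lambda>i\<in>I. s (t i))) (Pi\<^sub>E I A)
      = (\<Prod>i\<in>I. emeasure lborel (A i))" .
  qed (use I in auto)
  have "AE x in distr (PiM (t ` I) (\<lambda>_. lborel)) (?M I) (\<lambda>s. \<lambda>i\<in>I. s (t i)). P x"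
    unfolding eq by (rule ae)
  then show ?thesis by (rule AE_distrD[rotated]) measurable
qed

text \<open>\<open>power_transform\<close> is only meaningful for positive dimension; in dimension \<open>0\<close> the formula
  \<open>p / (1 - d p)\<close> degenerates to the identity.\<close>

definition power_transform0 :: "nat \<Rightarrow> ereal \<Rightarrow> ereal" where
  "power_transform0 n p = (if n = 0 then p else power_transform n p)"

text \<open>In terms of reciprocals the transform is 1/p \<mapsto> 1/p - n, so one more step
  subtracts 1. The bound 1 / (n + 1) on p is what keeps the n-th iterate at most 1, as the next
  one-dimensional step requires.\<close>

lemma power_transform0_Suc:
  assumes p: "p \<le> ereal (1 / real (Suc n))"
  shows "power_transform0 n p \<le> 1" "power_transform 1 (power_transform0 n p) = power_transform0 (Suc n) p"
proof -
  consider "n = 0" | "0 < n" "p = -\<infinity>" | r where "0 < n" "p = ereal r"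
    using p by (cases p) auto
  then have "power_transform0 n p \<le> 1 \<and> power_transform 1 (power_transform0 n p) = power_transform0 (Suc n) p"
  proof cases
    case 1
    then show ?thesis using p by (simp add: power_transform0_def one_ereal_def)
  next
    case 2
    moreover have "(- (1 / real n)) / (1 + 1 / real n) = - (1 / (1 + real n))"
      using \<open>0 < n\<close> by (simp add: field_simps)
    moreover have "- 1 \<le> 1 / real n" by (rule order_trans[of _ 0]) auto
    moreover have "- (1 / real n) \<noteq> 1" using \<open>0 < n\<close> by (simp add: field_simps)
    ultimately show ?thesis
      by (auto simp: power_transform0_def power_transform_def one_ereal_def add.commute)
  next
    case 3
    then have r: "r \<le> 1 / (1 + real n)" using p by (simp add: add.commute)
    then have rn: "r * (1 + real n) \<le> 1" by (simp add: field_simps)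
    have "1 / (1 + real n) < 1 / real n" using \<open>0 < n\<close> by (simp add: field_simps)
    with r have rne: "r \<noteq> 1 / real n" by linarith
    have pos: "0 < 1 - real n * r"
    proof -
      have "real n * r \<le> real n * (1 / (1 + real n))" using r by (intro mult_left_mono) auto
      also have "\<dots> < 1" by (simp add: field_simps)
      finally show ?thesis by simp
    qed
    define q where "q = r / (1 - real n * r)"
    have q: "power_transform0 n p = ereal q" using 3 rne by (simp add: power_transform0_def power_transform_def q_def)
    have q1: "q \<le> 1" using pos rn by (simp add: q_def field_simps)
    have qe: "q = 1 \<longleftrightarrow> r = 1 / (1 + real n)" using pos by (auto simp: q_def field_simps)
    have "power_transform 1 (ereal q) = power_transform0 (Suc n) p"
    proof (cases "q = 1")
      case True
      then show ?thesis using qe 3 by (simp add: power_transform0_def power_transform_def)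
    next
      case False
      then have "1 - (1 + real n) * r \<noteq> 0" using qe by (auto simp: field_simps)
      then have "q / (1 - q) = r / (1 - (1 + real n) * r)"
        using pos False by (simp add: q_def divide_simps) (simp add: algebra_simps)
      then show ?thesis using False qe 3 by (simp add: power_transform0_def power_transform_def)
    qed
    then show ?thesis using q q1 by (simp add: one_ereal_def)
  qed
  then show "power_transform0 n p \<le> 1" "power_transform 1 (power_transform0 n p) = power_transform0 (Suc n) p" by auto
qed

text \<open>A tuple of vectors with coordinates in \<open>I\<close> is encoded as a function \<open>x\<close> on \<open>UNIV \<times> I\<close>;
  \<open>entry I x i\<close> is its \<open>i\<close>-th vector.\<close>

definition entry :: "'k set \<Rightarrow> ('m \<times> 'k \<Rightarrow> real) \<Rightarrow> 'm \<Rightarrow> 'k \<Rightarrow> real" where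
  "entry I x i = (\<lambda>k\<in>I. x (i, k))"

definition entry_comb :: "real ^ 'm \<Rightarrow> 'k set \<Rightarrow> ('m::finite \<times> 'k \<Rightarrow> real) \<Rightarrow> 'k \<Rightarrow> real" where
  "entry_comb b I x = (\<lambda>k\<in>I. \<Sum>i\<in>UNIV. b $ i * x (i, k))"

text \<open>Split off coordinate j from all vectors. For almost all values of these coordinates the
  slices satisfy the hypothesis in the remaining ones, and the induction hypothesis bounds a power
  mean of ratios of marginals. This is the hypothesis of the one-dimensional case, with exponent
  \<open>power_transform0 (card I) p\<close>. Over the empty product, integration is evaluation at
  the only point.\<close>

lemma Borell_Brascamp_Lieb_PiM:
  fixes f g :: "'m::finite \<Rightarrow> ('k \<Rightarrow> real) \<Rightarrow> real"
  assumes w: "is_weight w" and b: "\<And>i. b $ i \<noteq> 0" and c: "0 < c"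
    and "finite I" and "I \<noteq> {} \<Longrightarrow> p \<le> ereal (1 / real (card I))"
    and "\<And>i. f i \<in> borel_measurable (PiM I (\<lambda>_. lborel))" "\<And>i x. 0 \<le> f i x"
    and "\<And>i. g i \<in> borel_measurable (PiM I (\<lambda>_. lborel))" "\<And>i x. 0 \<le> g i x"
    and "\<And>i. 0 < (\<integral>\<^sup>+x. f i x \<partial>PiM I (\<lambda>_. lborel))" "\<And>i. (\<integral>\<^sup>+x. f i x \<partial>PiM I (\<lambda>_. lborel)) < \<infinity>"
    and "\<And>i. (\<integral>\<^sup>+x. g i x \<partial>PiM I (\<lambda>_. lborel)) < \<infinity>"
    and "AE z in PiM I (\<lambda>_. lborel). R z"
    and "AE x in PiM (UNIV \<times> I) (\<lambda>_. lborel). (\<forall>i. 0 < f i (entry I x i)) \<longrightarrow> R (entry_comb b I x) \<longrightarrow>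
      c \<le> power_mean w p (\<chi> i. g i (entry_comb b I x) / f i (entry I x i))"
  shows "c \<le> power_mean w (power_transform0 (card I) p)
    (\<chi> i. (w $ i / \<bar>b $ i\<bar>) ^ card I *
      (enn2real (\<integral>\<^sup>+x. g i x \<partial>PiM I (\<lambda>_. lborel)) / enn2real (\<integral>\<^sup>+x. f i x \<partial>PiM I (\<lambda>_. lborel))))"
  using assms(4-)
proof (induction I arbitrary: f g R rule: finite_induct)
  case empty
  note prems = empty.prems
  let ?u = "\<lambda>_::'k. undefined :: real"
  have u: "entry {} x i = ?u" "entry_comb b {} x = ?u" for x i by (auto simp: entry_def entry_comb_def)
  have If: "(\<integral>\<^sup>+x. f i x \<partial>PiM {} (\<lambda>_. lborel)) = f i ?u" and Ig: "(\<integral>\<^sup>+x. g i x \<partial>PiM {} (\<lambda>_. lborel)) = g i ?u" for i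
    by (simp_all add: lborel_PiM.nn_integral_empty)
  have "0 < f i ?u" for i using prems(6)[of i] unfolding If by simp
  moreover have "R ?u" using prems(9) unfolding PiM_empty by (simp add: AE_count_space)
  ultimately have "c \<le> power_mean w p (\<chi> i. g i ?u / f i ?u)"
    using prems(10) unfolding Sigma_empty2 PiM_empty u by (simp add: AE_count_space)
  then show ?case unfolding If Ig using prems(3,5) by (simp add: power_transform0_def)
next
  case (insert j I)
  note prems = insert.prems
  let ?N = "PiM I (\<lambda>_. lborel :: real measure)" and ?N' = "PiM (insert j I) (\<lambda>_. lborel :: real measure)"
  interpret N: sigma_finite_measure ?N by (rule lborel_PiM.sigma_finite) fact
  note [measurable] = prems(2,4)
  let ?n = "card I"
  have p: "p \<le> ereal (1 / real (Suc ?n))" using prems(1) insert.hyps by simp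
  have pI: "I \<noteq> {} \<Longrightarrow> p \<le> ereal (1 / real ?n)"
    using insert.hyps(1) card_gt_0_iff[of I]
    by (intro order_trans[OF p]) (simp add: divide_left_mono)
  have kpos: "0 < w $ i / \<bar>b $ i\<bar>" for i using weightD(1)[OF w, of i] b[of i] by simp
  define IF where "IF i t = (\<integral>\<^sup>+y. f i (y(j := t)) \<partial>?N)" for i t
  define IG where "IG i t = (\<integral>\<^sup>+y. g i (y(j := t)) \<partial>?N)" for i t
  have [measurable]: "IF i \<in> borel_measurable borel" "IG i \<in> borel_measurable borel" for i
    unfolding IF_def[abs_def] IG_def[abs_def] by measurable
  have totF: "(\<integral>\<^sup>+t. IF i t \<partial>lborel) = (\<integral>\<^sup>+x. f i x \<partial>?N')" and totG: "(\<integral>\<^sup>+t. IG i t \<partial>lborel) = (\<integral>\<^sup>+x. g i x \<partial>?N')" for i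
    unfolding IF_def IG_def using insert.hyps
    by (simp_all add: lborel_PiM.product_nn_integral_insert_rev)
  have finF: "AE t in lborel. IF i t \<noteq> \<infinity>" and finG: "AE t in lborel. IG i t \<noteq> \<infinity>" for i
    using prems(7,8)[of i] unfolding totF[symmetric] totG[symmetric]
    by - (rule nn_integral_noteq_infinite; simp)+
  define F where "F i t = enn2real (IF i t)" for i t
  \<comment> \<open>The constants produced by the induction hypothesis are moved into
    \<open>G\<close>; the one-dimensional bound then contributes the last factor w_i /
    |b_i|.\<close>
  define G where "G i t = (w $ i / \<bar>b $ i\<bar>) ^ ?n * enn2real (IG i t)" for i t
  have "(\<integral>\<^sup>+t. F i t \<partial>lborel) = (\<integral>\<^sup>+t. IF i t \<partial>lborel)" for i
    unfolding F_def by (intro nn_integral_cong_AE eventually_mono[OF finF[of i]]) (simp add: less_top)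
  then have eqF: "(\<integral>\<^sup>+t. F i t \<partial>lborel) = (\<integral>\<^sup>+x. f i x \<partial>?N')" for i by (simp add: totF)
  have "(\<integral>\<^sup>+t. G i t \<partial>lborel) = (\<integral>\<^sup>+t. ennreal ((w $ i / \<bar>b $ i\<bar>) ^ ?n) * IG i t \<partial>lborel)" for i
    unfolding G_def
    by (intro nn_integral_cong_AE eventually_mono[OF finG[of i]]) (simp add: less_top ennreal_mult'')
  then have eqG: "(\<integral>\<^sup>+t. G i t \<partial>lborel) = ennreal ((w $ i / \<bar>b $ i\<bar>) ^ ?n) * (\<integral>\<^sup>+x. g i x \<partial>?N')" for i
    by (simp add: nn_integral_cmult totG)
  \<comment> \<open>Two kinds of values \<tau> are discarded: those for which \<open>R\<close> fails
    on a non-null part of the slice, and those where a marginal of g is infinite, so that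
    \<open>enn2real\<close> would replace it by 0.\<close>
  define R' where "R' \<tau> \<longleftrightarrow> (AE v in ?N. R (v(j := \<tau>))) \<and> (\<forall>i. IG i \<tau> \<noteq> \<infinity>)" for \<tau>
  have R': "AE \<tau> in lborel. R' \<tau>"
    unfolding R'_def AE_conj_iff AE_all_countable
    using AE_PiM_insert(2)[OF insert.hyps prems(9)] finG by blast
  have "UNIV \<times> insert j I = UNIV \<times> {j} \<union> UNIV \<times> I" by auto
  note ae = prems(10)[unfolded this]
  have disj: "(UNIV :: 'm set) \<times> {j} \<inter> UNIV \<times> I = {}" and fin: "finite ((UNIV :: 'm set) \<times> {j})" "finite ((UNIV :: 'm set) \<times> I)"
    and inj: "inj_on fst ((UNIV :: 'm set) \<times> {j})"
    using insert.hyps by (auto intro: inj_onI)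
  have fst: "fst ` (UNIV \<times> {j}) = (UNIV :: 'm set)" by force
  have entry: "entry (insert j I) (merge (UNIV \<times> {j}) (UNIV \<times> I) (\<lambda>k\<in>UNIV \<times> {j}. s (fst k), y)) i = (entry I y i)(j := s i)" for s y and i :: 'm
    using insert.hyps by (auto simp: entry_def merge_def fun_eq_iff)
  have comb: "entry_comb b (insert j I) (merge (UNIV \<times> {j}) (UNIV \<times> I) (\<lambda>k\<in>UNIV \<times> {j}. s (fst k), y)) = (entry_comb b I y)(j := \<Sum>i\<in>UNIV. b $ i * s i)" for s y
    using insert.hyps by (auto simp: entry_comb_def merge_def fun_eq_iff)
  have "AE s in PiM UNIV (\<lambda>_. lborel). AE y in PiM (UNIV \<times> I) (\<lambda>_. lborel).
      (\<forall>i. 0 < f i ((entry I y i)(j := s i))) \<longrightarrow> R ((entry_comb b I y)(j := \<Sum>i\<in>UNIV. b $ i * s i)) \<longrightarrow>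
      c \<le> power_mean w p (\<chi> i. g i ((entry_comb b I y)(j := \<Sum>i\<in>UNIV. b $ i * s i)) / f i ((entry I y i)(j := s i)))"
    using AE_PiM_reindex[OF fin(1) inj AE_PiM_Un[OF disj fin ae]] unfolding fst entry comb .
  then have aeF: "AE s in PiM UNIV (\<lambda>_. lborel). (\<forall>i. 0 < F i (s i)) \<longrightarrow> R' (\<Sum>i\<in>UNIV. b $ i * s i) \<longrightarrow>
      c \<le> power_mean w (power_transform0 ?n p) (\<chi> i. G i (\<Sum>i\<in>UNIV. b $ i * s i) / F i (s i))"
  proof eventually_elim
    case (elim s)
    let ?\<tau> = "\<Sum>i\<in>UNIV. b $ i * s i"
    show ?case
    proof (intro impI)
      assume F: "\<forall>i. 0 < F i (s i)" and "R' ?\<tau>"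
      have "c \<le> power_mean w (power_transform0 ?n p) (\<chi> i. (w $ i / \<bar>b $ i\<bar>) ^ ?n *
          (enn2real (\<integral>\<^sup>+x. g i (x(j := ?\<tau>)) \<partial>?N) / enn2real (\<integral>\<^sup>+x. f i (x(j := s i)) \<partial>?N)))"
      proof (rule insert.IH[where R="\<lambda>v. R (v(j := ?\<tau>))"])
        \<comment> \<open>\<open>enn2real\<close> sends \<infinity> to 0, so
          \<open>0 < F i (s i)\<close> gives finiteness of the slice integral along with
          positivity.\<close>
        show "0 < (\<integral>\<^sup>+x. f i (x(j := s i)) \<partial>?N)" "(\<integral>\<^sup>+x. f i (x(j := s i)) \<partial>?N) < \<infinity>" for i
          using F[rule_format, of i] by (auto simp: F_def IF_def enn2real_positive_iff)
        show "(\<integral>\<^sup>+x. g i (x(j := ?\<tau>)) \<partial>?N) < \<infinity>" for i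
          using \<open>R' ?\<tau>\<close> by (auto simp: R'_def IG_def less_top)
        show "(\<lambda>y. f i (y(j := s i))) \<in> borel_measurable ?N" "(\<lambda>y. g i (y(j := ?\<tau>))) \<in> borel_measurable ?N" for i
          by measurable
        show "AE z in ?N. R (z(j := ?\<tau>))" using \<open>R' ?\<tau>\<close> by (simp add: R'_def)
      qed (use prems(3,5) pI elim in blast)+
      then show "c \<le> power_mean w (power_transform0 ?n p) (\<chi> i. G i ?\<tau> / F i (s i))"
        by (simp add: F_def G_def IF_def IG_def)
    qed
  qed
  have "c \<le> power_mean w (power_transform 1 (power_transform0 ?n p))
    (\<chi> i. w $ i / \<bar>b $ i\<bar> * (enn2real (\<integral>\<^sup>+x. G i x \<partial>lborel) / enn2real (\<integral>\<^sup>+x. F i x \<partial>lborel)))"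
  proof (rule Borell_Brascamp_Lieb_real[OF w power_transform0_Suc(1)[OF p] b c _ _ _ _ _ _ _ R' aeF])
    show "0 \<le> G i x" for i x
      unfolding G_def by (intro mult_nonneg_nonneg zero_le_power less_imp_le[OF kpos]) auto
    show "(\<integral>\<^sup>+x. G i x \<partial>lborel) < \<infinity>" for i
      unfolding eqG using prems(8)[of i] by (simp add: ennreal_mult_less_top)
    show "0 < (\<integral>\<^sup>+x. F i x \<partial>lborel)" "(\<integral>\<^sup>+x. F i x \<partial>lborel) < \<infinity>" for i
      unfolding eqF by (fact prems(6,7))+
  qed (auto simp: F_def[abs_def] G_def[abs_def])
  also have "power_transform 1 (power_transform0 ?n p) = power_transform0 (card (insert j I)) p"
    using power_transform0_Suc(2)[OF p] insert.hyps by simp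
  also have "(\<chi> i. w $ i / \<bar>b $ i\<bar> * (enn2real (\<integral>\<^sup>+x. G i x \<partial>lborel) / enn2real (\<integral>\<^sup>+x. F i x \<partial>lborel)))
    = (\<chi> i. (w $ i / \<bar>b $ i\<bar>) ^ card (insert j I) * (enn2real (\<integral>\<^sup>+x. g i x \<partial>?N') / enn2real (\<integral>\<^sup>+x. f i x \<partial>?N')))"
    unfolding eqF eqG using insert.hyps kpos by (simp add: enn2real_mult less_imp_le mult_ac)
  finally show ?case .
qed

section \<open>The upper bound\<close>

text \<open>A map that matches coordinates pulls boxes back to products of boxes, and boxes
  determine Lebesgue measure. The general enumeration \<open>e\<close> of the basis covers vectors
  as well as vectors of vectors flattened to one index set.\<close>

lemma lborel_eq_distr_PiM:
  fixes T :: "('k::finite \<Rightarrow> 'a::euclidean_space) \<Rightarrow> 'v::euclidean_space" and e :: "'k \<Rightarrow> 'a \<Rightarrow> 'v"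
  assumes e: "bij_betw (\<lambda>(k, u). e k u) (UNIV \<times> Basis) Basis"
    and T: "\<And>x k u. u \<in> Basis \<Longrightarrow> T x \<bullet> e k u = x k \<bullet> u"
  shows "T \<in> measurable (PiM UNIV (\<lambda>_. lborel)) borel"
    and "distr (PiM UNIV (\<lambda>_. lborel)) borel T = lborel"
proof -
  have inBasis: "e k u \<in> Basis" if "u \<in> Basis" for k u
    using bij_betwE[OF e] that by auto
  have Basis: "\<exists>k u. u \<in> Basis \<and> v = e k u" if "v \<in> Basis" for v
    using that unfolding bij_betw_imp_surj_on[OF e, symmetric] by auto
  show meas: "T \<in> measurable (PiM UNIV (\<lambda>_. lborel)) borel"
    unfolding borel_measurable_euclidean_space[of T]
  proof
    fix v :: 'v assume "v \<in> Basis"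
    then obtain k u where "u \<in> Basis" "v = e k u" using Basis by blast
    then show "(\<lambda>x. T x \<bullet> v) \<in> borel_measurable (PiM UNIV (\<lambda>_. lborel))" by (simp add: T)
  qed
  show "distr (PiM UNIV (\<lambda>_. lborel)) borel T = lborel"
  proof (rule lborel_eqI[symmetric])
    fix l u :: 'v assume le: "\<And>v. v \<in> Basis \<Longrightarrow> l \<bullet> v \<le> u \<bullet> v"
    define L where "L k = (\<Sum>v\<in>Basis. (l \<bullet> e k v) *\<^sub>R v)" for k
    define U where "U k = (\<Sum>v\<in>Basis. (u \<bullet> e k v) *\<^sub>R v)" for k
    have LU: "L k \<bullet> v = l \<bullet> e k v" "U k \<bullet> v = u \<bullet> e k v" if "v \<in> Basis" for k v
      using that by (simp_all add: L_def U_def)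
    have "T x \<in> box l u \<longleftrightarrow> (\<forall>k. x k \<in> box (L k) (U k))" for x
    proof -
      have "T x \<in> box l u \<longleftrightarrow> (\<forall>k. \<forall>v\<in>Basis. l \<bullet> e k v < T x \<bullet> e k v \<and> T x \<bullet> e k v < u \<bullet> e k v)"
        unfolding mem_box using Basis inBasis by metis
      then show ?thesis by (simp add: mem_box LU T)
    qed
    then have "T -` box l u \<inter> space (PiM UNIV (\<lambda>_. lborel)) = (\<Pi>\<^sub>E k\<in>UNIV. box (L k) (U k))"
      by (auto simp: space_PiM PiE_UNIV_domain)
    then have "emeasure (distr (PiM UNIV (\<lambda>_. lborel)) borel T) (box l u) = (\<Prod>k\<in>UNIV. emeasure lborel (box (L k) (U k)))"
      using meas by (simp add: emeasure_distr lborel_PiM.emeasure_PiM)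
    also have "\<dots> = (\<Prod>k\<in>UNIV. \<Prod>v\<in>Basis. ennreal ((u - l) \<bullet> e k v))"
      by (intro prod.cong refl) (simp add: emeasure_lborel_box LU le inBasis inner_diff_left prod_ennreal)
    also have "\<dots> = (\<Prod>(k, v)\<in>UNIV \<times> Basis. ennreal ((u - l) \<bullet> e k v))"
      by (rule prod.Sigma) auto
    also have "\<dots> = (\<Prod>v\<in>Basis. ennreal ((u - l) \<bullet> v))"
      using prod.reindex_bij_betw[OF e, of "\<lambda>v. ennreal ((u - l) \<bullet> v)"] by (simp add: case_prod_unfold)
    also have "\<dots> = ennreal (\<Prod>v\<in>Basis. (u - l) \<bullet> v)"
      using le by (intro prod_ennreal) (simp add: inner_diff_left)
    finally show "emeasure (distr (PiM UNIV (\<lambda>_. lborel)) borel T) (box l u) = ennreal (\<Prod>v\<in>Basis. (u - l) \<bullet> v)" .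
  qed simp
qed

lemma bij_betw_axis:
  "bij_betw (\<lambda>(i, u). axis i u) (UNIV \<times> Basis) (Basis :: ('a::euclidean_space ^ 'n::finite) set)"
  by (auto simp: bij_betw_def inj_on_def axis_eq_axis Basis_vec_def)

lemma lborel_vec:
  "(\<lambda>x. \<chi> i. x i) \<in> measurable (PiM UNIV (\<lambda>_::'n. lborel)) (borel :: ('a::euclidean_space ^ 'n::finite) measure)"
  "distr (PiM UNIV (\<lambda>_. lborel)) borel (\<lambda>x. \<chi> i. x i) = (lborel :: ('a::euclidean_space ^ 'n::finite) measure)"
  by (rule lborel_eq_distr_PiM[OF bij_betw_axis]; simp add: inner_axis)+

lemma lborel_vec_vec:
  "(\<lambda>x. \<chi> i k. x (i, k)) \<in> measurable (PiM UNIV (\<lambda>_::'m \<times> 'd. lborel)) (borel :: (real ^ 'd::finite ^ 'm::finite) measure)"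
  "distr (PiM UNIV (\<lambda>_. lborel)) borel (\<lambda>x. \<chi> i k. x (i, k)) = (lborel :: (real ^ 'd::finite ^ 'm::finite) measure)"
proof -
  have "bij_betw (\<lambda>(k, u). axis (fst k) (axis (snd k) u)) (UNIV \<times> Basis) (Basis :: (real ^ 'd ^ 'm) set)"
    by (force simp: bij_betw_def inj_on_def axis_eq_axis Basis_vec_def image_iff)
  from lborel_eq_distr_PiM[OF this, of "\<lambda>x. \<chi> i k. x (i, k)"]
  show "(\<lambda>x. \<chi> i k. x (i, k)) \<in> measurable (PiM UNIV (\<lambda>_::'m \<times> 'd. lborel)) (borel :: (real ^ 'd::finite ^ 'm::finite) measure)"
    "distr (PiM UNIV (\<lambda>_. lborel)) borel (\<lambda>x. \<chi> i k. x (i, k)) = (lborel :: (real ^ 'd::finite ^ 'm::finite) measure)"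
    by (simp_all add: inner_axis)
qed

lemma borel_measurable_vec_nth [measurable]:
  "(\<lambda>x :: 'a::euclidean_space ^ 'n::finite. x $ i) \<in> borel_measurable borel"
  by (intro borel_measurable_continuous_onI continuous_intros)

text \<open>The exceptional set lies in a cylinder whose product measure has a factor 0, and 0
  \<cdot> \<infinity> = 0.\<close>

lemma AE_lborel_vec_component:
  assumes "AE y in lborel. P y"
  shows "AE x :: 'a::euclidean_space ^ 'n::finite in lborel. P (x $ i)"
proof -
  obtain N where N: "\<And>y. y \<in> space lborel - N \<Longrightarrow> P y" "N \<in> null_sets lborel"
    using AE_E3[OF assms] by blast
  have [measurable]: "N \<in> sets borel" using N(2) by auto
  let ?A = "\<lambda>k. if k = i then N else UNIV"
  have pre: "{x :: 'a ^ 'n. x $ i \<in> N} \<in> sets borel" by measurable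
  have "emeasure lborel {x :: 'a ^ 'n. x $ i \<in> N}
      = emeasure (PiM UNIV (\<lambda>_. lborel)) ((\<lambda>x. \<chi> i. x i) -` {x :: 'a ^ 'n. x $ i \<in> N} \<inter> space (PiM UNIV (\<lambda>_::'n. lborel)))"
    by (subst lborel_vec(2)[symmetric], subst emeasure_distr[OF lborel_vec(1) pre]) simp
  also have "(\<lambda>x. \<chi> i. x i) -` {x :: 'a ^ 'n. x $ i \<in> N} \<inter> space (PiM UNIV (\<lambda>_::'n. lborel)) = Pi\<^sub>E UNIV ?A"
    by (auto simp: space_PiM PiE_iff split: if_splits)
  also have "emeasure (PiM UNIV (\<lambda>_. lborel)) \<dots> = (\<Prod>k\<in>UNIV. emeasure lborel (?A k))"
    by (intro lborel_PiM.emeasure_PiM) auto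
  also have "\<dots> = 0" using N(2) by (intro prod_zero) (auto intro!: exI[of _ i])
  finally have "{x :: 'a ^ 'n. x $ i \<in> N} \<in> null_sets lborel" using pre by (intro null_setsI) auto
  then have "AE x :: 'a ^ 'n in lborel. x $ i \<notin> N" using AE_not_in by fastforce
  then show ?thesis by (rule eventually_mono) (use N(1) in auto)
qed

section \<open>Borel versions and the bound for the essential infimum\<close>

text \<open>Passes from Lebesgue measurable functions to the Borel functions of the product
  argument. The maximum with 0 keeps the version nonnegative everywhere, not only almost
  everywhere.\<close>

lemma ex_borel_version:
  fixes f :: "'a::euclidean_space \<Rightarrow> real"
  assumes "integrable lebesgue f" "\<And>x. 0 \<le> f x"
  shows "\<exists>f'\<in>borel_measurable borel. (\<forall>x. 0 \<le> f' x) \<and> (AE x in lborel. f x = f' x) \<and>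
    (\<integral>\<^sup>+x. f' x \<partial>lborel) < \<infinity> \<and> L1_norm f = enn2real (\<integral>\<^sup>+x. f' x \<partial>lborel)"
proof -
  obtain h where h[measurable]: "h \<in> borel_measurable lborel" and fh: "AE x in lborel. f x = h x"
    using completion_ex_borel_measurable_real borel_measurable_integrable[OF assms(1)] by blast
  define f' where "f' x = max 0 (h x)" for x
  have ae: "AE x in lborel. f x = f' x"
    using fh by eventually_elim (metis assms(2) f'_def max.absorb2)
  have "(\<integral>\<^sup>+x. f x \<partial>lebesgue) = (\<integral>\<^sup>+x. f x \<partial>lborel)" by (simp add: nn_integral_completion)
  also have "\<dots> = (\<integral>\<^sup>+x. f' x \<partial>lborel)" by (intro nn_integral_cong_AE) (use ae in eventually_elim, simp)
  finally have eq: "(\<integral>\<^sup>+x. f x \<partial>lebesgue) = (\<integral>\<^sup>+x. f' x \<partial>lborel)" .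
  have "(\<integral>\<^sup>+x. f x \<partial>lebesgue) < \<infinity>"
    using assms by (simp add: integrable_iff_bounded)
  moreover have "L1_norm f = enn2real (\<integral>\<^sup>+x. f x \<partial>lebesgue)"
    unfolding L1_norm_def using assms by (simp add: integral_eq_nn_integral borel_measurable_integrable)
  ultimately show ?thesis using ae unfolding eq by (intro bexI[of _ f']) (auto simp: f'_def[abs_def])
qed

text \<open>Borel versions replace f and g. For f the exceptional tuples form a null set, because
  each component avoids a null set almost everywhere; for g the exceptions concern the point z and
  become the predicate \<open>R\<close>.\<close>

lemma K_const_le:
  fixes w b :: "real ^ 'm::finite" and f g :: "'m \<Rightarrow> real ^ 'd::finite \<Rightarrow> real"
  assumes w: "is_weight w" and p: "p \<le> ereal (1 / real CARD('d))" and b: "\<And>i. b $ i \<noteq> 0"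
    and adm: "admissible f g"
  shows "K_const w p b f g \<le> ereal (power_mean w (power_transform CARD('d) p) (norm_ratios w b f g))"
proof -
  have f0: "0 \<le> f i x" and g0: "0 \<le> g i x" and fi: "integrable lebesgue (f i)" and gi: "integrable lebesgue (g i)"
    and fpos: "0 < L1_norm (f i)" for i x
    using adm by (auto simp: admissible_def)
  define V where "V = power_mean w (power_transform CARD('d) p) (norm_ratios w b f g)"
  have "\<forall>i. \<exists>f'. f' \<in> borel_measurable borel \<and> (\<forall>x. 0 \<le> f' x) \<and> (AE x in lborel. f i x = f' x) \<and>
      (\<integral>\<^sup>+x. f' x \<partial>lborel) < \<infinity> \<and> L1_norm (f i) = enn2real (\<integral>\<^sup>+x. f' x \<partial>lborel)"
    using ex_borel_version[OF fi f0] by blast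
  then obtain f' where f'[measurable]: "\<And>i. f' i \<in> borel_measurable borel" and f'0: "\<And>i x. 0 \<le> f' i x"
    and ff': "\<And>i. AE x in lborel. f i x = f' i x" and f'fin: "\<And>i. (\<integral>\<^sup>+x. f' i x \<partial>lborel) < \<infinity>"
    and Lf: "\<And>i. L1_norm (f i) = enn2real (\<integral>\<^sup>+x. f' i x \<partial>lborel)"
    unfolding choice_iff by blast
  have "\<forall>i. \<exists>g'. g' \<in> borel_measurable borel \<and> (\<forall>x. 0 \<le> g' x) \<and> (AE x in lborel. g i x = g' x) \<and>
      (\<integral>\<^sup>+x. g' x \<partial>lborel) < \<infinity> \<and> L1_norm (g i) = enn2real (\<integral>\<^sup>+x. g' x \<partial>lborel)"
    using ex_borel_version[OF gi g0] by blast
  then obtain g' where g'[measurable]: "\<And>i. g' i \<in> borel_measurable borel" and g'0: "\<And>i x. 0 \<le> g' i x"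
    and gg': "\<And>i. AE x in lborel. g i x = g' i x" and g'fin: "\<And>i. (\<integral>\<^sup>+x. g' i x \<partial>lborel) < \<infinity>"
    and Lg: "\<And>i. L1_norm (g i) = enn2real (\<integral>\<^sup>+x. g' i x \<partial>lborel)"
    unfolding choice_iff by blast
  have ffx: "AE x :: real ^ 'd ^ 'm in lborel. \<forall>i. f i (x $ i) = f' i (x $ i)"
    unfolding AE_all_countable by (intro allI AE_lborel_vec_component ff')
  \<comment> \<open>Measurability of \<open>pos_prod f\<close> turns a statement almost everywhere
    on it into an implication almost everywhere. It holds by completeness, since the set agrees with
    a Borel set off a null set.\<close>
  have S: "pos_prod f \<in> sets lebesgue"
  proof -
    define S' where "S' = {x :: real ^ 'd ^ 'm. \<forall>i. 0 < f' i (x $ i)}"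
    have "S' \<in> sets borel" unfolding S'_def by measurable
    obtain N where N: "\<And>x :: real ^ 'd ^ 'm. x \<in> space lborel - N \<Longrightarrow> \<forall>i. f i (x $ i) = f' i (x $ i)" "N \<in> null_sets lborel"
      using AE_E3[OF ffx] by blast
    have "pos_prod f = (S' - N) \<union> (pos_prod f \<inter> N)"
      using N(1) unfolding pos_prod_def pos_set_def S'_def by auto metis+
    moreover have "S' - N \<in> sets lebesgue" using \<open>S' \<in> sets borel\<close> N(2) by auto
    moreover have "pos_prod f \<inter> N \<in> null_sets lebesgue"
      by (rule null_sets_completion_subset[OF _ null_sets_completionI[OF N(2)]]) simp
    ultimately show ?thesis by (metis null_setsD2 sets.Un)
  qed
  have main: "c \<le> V" if c: "0 < c" and ae: "AE x in lebesgue_on (pos_prod f).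
      ereal c \<le> ereal (power_mean w p (\<chi> i. g i (lin_comb b x) / f i (x $ i)))" for c
  proof -
    have "AE x in lborel. x \<in> pos_prod f \<longrightarrow> c \<le> power_mean w p (\<chi> i. g i (lin_comb b x) / f i (x $ i))"
      using ae S by (simp add: AE_restrict_space_iff AE_completion_iff)
    then have "AE x :: real ^ 'd ^ 'm in lborel. (\<forall>i. 0 < f' i (x $ i)) \<longrightarrow> (\<forall>i. g i (lin_comb b x) = g' i (lin_comb b x)) \<longrightarrow>
        c \<le> power_mean w p (\<chi> i. g' i (lin_comb b x) / f' i (x $ i))"
      using ffx by eventually_elim (auto simp: pos_prod_def pos_set_def)
    then have "AE x in distr (PiM UNIV (\<lambda>_. lborel)) borel (\<lambda>x. \<chi> i k. x (i, k)).
        (\<forall>i. 0 < f' i (x $ i)) \<longrightarrow> (\<forall>i. g i (lin_comb b x) = g' i (lin_comb b x)) \<longrightarrow>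
        c \<le> power_mean w p (\<chi> i. g' i (lin_comb b (x :: real ^ 'd ^ 'm)) / f' i (x $ i))"
      unfolding lborel_vec_vec(2) .
    note flat = AE_distrD[OF lborel_vec_vec(1) this]
    have ae': "AE x in PiM (UNIV \<times> UNIV :: ('m \<times> 'd) set) (\<lambda>_. lborel).
        (\<forall>i. 0 < f' i (vec_lambda (entry UNIV x i))) \<longrightarrow>
        (\<forall>i. g i (vec_lambda (entry_comb b UNIV x)) = g' i (vec_lambda (entry_comb b UNIV x))) \<longrightarrow>
        c \<le> power_mean w p (\<chi> i. g' i (vec_lambda (entry_comb b UNIV x)) / f' i (vec_lambda (entry UNIV x i)))"
    proof -
      have "vec_lambda (entry UNIV x i) = (\<chi> k. x (i, k))" for x :: "'m \<times> 'd \<Rightarrow> real" and i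
        by (simp add: entry_def restrict_UNIV)
      moreover have "vec_lambda (entry_comb b UNIV x) = lin_comb b (\<chi> i k. x (i, k))" for x :: "'m \<times> 'd \<Rightarrow> real"
        by (simp add: entry_comb_def lin_comb_def vec_eq_iff)
      ultimately show ?thesis using flat unfolding UNIV_Times_UNIV by simp
    qed
    have int: "(\<integral>\<^sup>+y. F (vec_lambda y) \<partial>PiM UNIV (\<lambda>_::'d. lborel)) = (\<integral>\<^sup>+x. F x \<partial>lborel)"
      if "F \<in> borel_measurable borel" for F :: "real ^ 'd \<Rightarrow> real"
      using that lborel_vec(1)[where 'n='d and 'a=real]
      by (subst lborel_vec(2)[symmetric]) (simp add: nn_integral_distr)
    have "AE z in distr (PiM UNIV (\<lambda>_::'d. lborel)) borel (\<lambda>x. \<chi> i. x i). \<forall>i. g i z = g' i z"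
      unfolding lborel_vec(2) AE_all_countable using gg' by blast
    then have R: "AE z in PiM UNIV (\<lambda>_::'d. lborel). \<forall>i. g i (vec_lambda z) = g' i (vec_lambda z)"
      by (rule AE_distrD[OF lborel_vec(1)])
    have [measurable]: "vec_lambda \<in> measurable (PiM UNIV (\<lambda>_. lborel)) (borel :: (real ^ 'd) measure)"
      using lborel_vec(1)[where 'n='d and 'a=real] by simp
    have "c \<le> power_mean w (power_transform0 CARD('d) p)
      (\<chi> i. (w $ i / \<bar>b $ i\<bar>) ^ CARD('d) *
        (enn2real (\<integral>\<^sup>+x. g' i (vec_lambda x) \<partial>PiM UNIV (\<lambda>_::'d. lborel)) /
         enn2real (\<integral>\<^sup>+x. f' i (vec_lambda x) \<partial>PiM UNIV (\<lambda>_::'d. lborel))))"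
    proof (rule Borell_Brascamp_Lieb_PiM[OF w b c, where R = "\<lambda>z. \<forall>i. g i (vec_lambda z) = g' i (vec_lambda z)"])
      show "0 < (\<integral>\<^sup>+x. f' i (vec_lambda x) \<partial>PiM UNIV (\<lambda>_::'d. lborel))" for i
        using fpos[of i] by (simp add: int Lf enn2real_positive_iff)
    qed (use p f'0 g'0 f'fin g'fin R ae' in \<open>auto simp: int\<close>)
    then show ?thesis
      unfolding V_def norm_ratios_def Lf Lg by (simp add: int power_transform0_def)
  qed
  have V0: "0 \<le> V"
    unfolding V_def
  proof (intro power_mean_nonneg)
    show "0 \<le> norm_ratios w b f g $ i" for i
      using weightD(1)[OF w, of i] by (simp add: norm_ratios_def Lf Lg less_imp_le)
  qed
  show ?thesis
    unfolding K_const_def ess_inf_def V_def[symmetric]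
  proof (rule Sup_least, clarify)
    fix e :: ereal
    assume ae: "AE x in lebesgue_on (pos_prod f). e \<le> ereal (power_mean w p (\<chi> i. g i (lin_comb b x) / f i (x $ i)))"
    \<comment> \<open>As V \<ge> 0, only positive r require the analytic bound. Testing all reals r
      below e also rules out e = \<infinity>.\<close>
    have "r \<le> V" if "ereal r \<le> e" for r
    proof (cases "0 < r")
      case True
      then show ?thesis by (rule main) (rule eventually_mono[OF ae], rule order_trans[OF that])
    qed (use V0 in simp)
    then show "e \<le> ereal V"
    proof (cases e)
      case PInf
      then show ?thesis using \<open>\<And>r. ereal r \<le> e \<Longrightarrow> r \<le> V\<close>[of "V + 1"] by simp
    qed auto
  qed
qed

section \<open>Sharpness\<close>

lemma power_mean_pos:
  assumes w: "is_weight w" and a: "\<And>i. 0 < a $ i"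
  shows "0 < power_mean w p a"
proof -
  define k where "k = Min (range (($) a))"
  have "0 < k" unfolding k_def using a by (subst Min_gr_iff) auto
  have "k = power_mean w p (\<chi> i. k)" using power_mean_const[OF w \<open>0 < k\<close>] by simp
  also have "\<dots> \<le> power_mean w p a"
    by (intro power_mean_mono w) (use \<open>0 < k\<close> in simp, simp add: k_def)
  finally show ?thesis using \<open>0 < k\<close> by simp
qed

section \<open>Strict monotonicity of power means in the exponent\<close>

text \<open>With m the weighted mean of x and 1, use ln y \<le> y - 1 at x / m and at 1 / m: the
  weighted right-hand sides cancel, and the first inequality is strict because x \<noteq> m.\<close>

lemma powr_less_tangent:
  fixes x s :: real
  assumes x: "0 < x" "x \<noteq> 1" and s: "0 < s" "s < 1"
  shows "x powr s < 1 + s * (x - 1)"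
proof -
  define m where "m = 1 + s * (x - 1)"
  have "m = (1 - s) + s * x" by (simp add: m_def algebra_simps)
  then have m: "0 < m" using x s by (simp add: add_pos_pos)
  have "x - m = (1 - s) * (x - 1)" by (simp add: m_def algebra_simps)
  then have "x / m \<noteq> 1" using x s m by auto
  then have "ln (x / m) < x / m - 1"
    using ln_le_minus_one[of "x / m"] ln_eq_minus_one[of "x / m"] x m by fastforce
  then have 1: "s * ln (x / m) < s * (x / m - 1)" using s by simp
  have 2: "(1 - s) * ln (1 / m) \<le> (1 - s) * (1 / m - 1)"
    using s m by (intro mult_left_mono ln_le_minus_one) auto
  have "s * (x / m - 1) + (1 - s) * (1 / m - 1) = 0"
    using m by (simp add: field_simps) (simp add: m_def algebra_simps)
  with 1 2 have "s * ln (x / m) + (1 - s) * ln (1 / m) < 0" by linarith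
  then have "s * ln x < ln m" using x m by (simp add: ln_div algebra_simps)
  then have "x powr s < exp (ln m)" using x by (simp add: powr_def)
  then show ?thesis using m by (simp add: m_def)
qed

text \<open>Both ranges reduce to exponents in (0, 1) by inverting a power. For s > 1 the base is
  \<open>x powr s\<close> with exponent 1 / s; for s < 0 it is \<open>x powr (s - 1)\<close>, whose
  power 1 / (1 - s) equals 1 / x.\<close>

lemma powr_greater_tangent:
  fixes x s :: real
  assumes x: "0 < x" "x \<noteq> 1" and s: "s < 0 \<or> 1 < s"
  shows "1 + s * (x - 1) < x powr s"
proof (cases "s < 0")
  case True
  define y where "y = x powr (s - 1)"
  define t where "t = 1 / (1 - s)"
  have t: "0 < t" "t < 1" "(s - 1) * t = - 1" using True by (auto simp: t_def field_simps)
  have y: "0 < y" "y \<noteq> 1" using x True by (auto simp: y_def)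
  have "y powr t = 1 / x" using x t(3) by (simp add: y_def powr_powr powr_minus divide_inverse)
  then have "1 / x < 1 + t * (y - 1)" using powr_less_tangent[OF y t(1,2)] by simp
  then have "(1 - s) < (1 - s) * x + (y - 1) * x"
    using True x by (simp add: t_def field_simps)
  moreover have "y * x = x powr s" using x by (simp add: y_def powr_diff)
  ultimately show ?thesis by (simp add: algebra_simps)
next
  case False
  then have s: "1 < s" using s by simp
  have y: "0 < x powr s" "x powr s \<noteq> 1" using x s by auto
  have "(x powr s) powr (1 / s) = x" using x s by (simp add: powr_powr)
  then have "x < 1 + (1 / s) * (x powr s - 1)" using powr_less_tangent[OF y, of "1 / s"] s by simp
  then show ?thesis using s by (simp add: field_simps)
qed

lemma sum_weight_less:
  fixes w :: "real ^ 'm::finite"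
  assumes w: "is_weight w" and "\<And>i. u i \<le> v i" "u j < v j"
  shows "(\<Sum>i\<in>UNIV. w $ i * u i) < (\<Sum>i\<in>UNIV. w $ i * v i)"
  using assms weightD(1)[OF w] by (intro sum_strict_mono_ex1) (auto intro!: mult_left_mono less_imp_le)

lemma sum_weight_affine:
  assumes "is_weight w"
  shows "(\<Sum>i\<in>UNIV. w $ i * (1 + s * (x i - 1))) = 1 + s * ((\<Sum>i\<in>UNIV. w $ i * x i) - 1)"
proof -
  have "(\<Sum>i\<in>UNIV. w $ i * (1 + s * (x i - 1)))
      = (\<Sum>i\<in>UNIV. w $ i) + s * ((\<Sum>i\<in>UNIV. w $ i * x i) - (\<Sum>i\<in>UNIV. w $ i))"
    by (simp add: algebra_simps sum.distrib sum_subtractf sum_distrib_left)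
  then show ?thesis using weightD(2)[OF assms] by simp
qed

text \<open>For nonzero exponents, the powers B_i = x_i^q' have weighted sum 1 and x_i^q = B_i^s
  with s = q / q'. Comparing B_i^s with its tangent at 1, whose weighted sum is again 1, decides on
  which side of 1 the sum of the x_i^q lies. If q or q' is 0, logarithms take the place of the
  corresponding powers.\<close>

lemma power_mean_normalized_less:
  fixes w x :: "real ^ 'm::finite" and q q' :: real
  assumes w: "is_weight w" and x: "\<And>i. 0 < x $ i" "x $ j \<noteq> 1" and qq: "q < q'"
    and one: "power_mean w (ereal q') x = 1"
  shows "power_mean w (ereal q) x < 1"
proof -
  have x0: "x $ i \<noteq> 0" for i using x(1)[of i] by simp
  have sum_pos: "0 < (\<Sum>i\<in>UNIV. w $ i * x $ i powr t)" for t
    by (intro sum_pos mult_pos_pos) (use weightD(1)[OF w] x0 in auto)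
  \<comment> \<open>The exponent 1 / q reverses the inequality for negative q, hence the opposite
    conditions on the sum.\<close>
  have root: "power_mean w (ereal q) x < 1"
    if "q > 0 \<Longrightarrow> (\<Sum>i\<in>UNIV. w $ i * x $ i powr q) < 1" "q < 0 \<Longrightarrow> 1 < (\<Sum>i\<in>UNIV. w $ i * x $ i powr q)" "q \<noteq> 0"
    using that sum_pos[of q] x0
    by (cases "q > 0") (auto simp: power_mean_real powr_less_one powr01_less_one powr_less_cancel_iff less_imp_le
        powr_less_mono2_neg[of "1 / q" 1 "\<Sum>i\<in>UNIV. w $ i * x $ i powr q"] powr_less_mono2[of "1 / q" "\<Sum>i\<in>UNIV. w $ i * x $ i powr q" 1])
  have lnprod: "power_mean w 0 x = exp (\<Sum>i\<in>UNIV. w $ i * ln (x $ i))"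
    using x0 by (simp add: power_mean_0 exp_sum powr_def)
  show ?thesis
  proof (cases "q' = 0")
    case True
    then have ln0: "(\<Sum>i\<in>UNIV. w $ i * ln (x $ i)) = 0" using one lnprod by (simp add: zero_ereal_def)
    have q: "q < 0" using qq True by simp
    have "(\<Sum>i\<in>UNIV. w $ i * (1 + q * ln (x $ i))) < (\<Sum>i\<in>UNIV. w $ i * x $ i powr q)"
    proof (rule sum_weight_less[OF w])
      show "1 + q * ln (x $ i) \<le> x $ i powr q" for i
        using exp_ge_add_one_self[of "q * ln (x $ i)"] x0 by (simp add: powr_def)
      define y where "y = q * ln (x $ j)"
      have "y \<noteq> 0" using x x0 q by (simp add: y_def)
      then have "exp y \<noteq> 1 + y" using ln_eq_minus_one[of "exp y"] by (metis add_diff_cancel_left' exp_eq_one_iff exp_gt_zero ln_exp)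
      then have "1 + y < exp y" using exp_ge_add_one_self[of y] by linarith
      then show "1 + q * ln (x $ j) < x $ j powr q" using x0 by (simp add: powr_def y_def)
    qed
    moreover have "(\<Sum>i\<in>UNIV. w $ i * (1 + q * ln (x $ i))) = 1"
      using ln0 weightD(2)[OF w] by (simp add: distrib_left sum.distrib mult.left_commute flip: sum_distrib_left)
    ultimately show ?thesis using q by (intro root) auto
  next
    case q'0: False
    define B where "B i = x $ i powr q'" for i
    have B: "0 < B i" for i using x0 by (simp add: B_def)
    have Bj: "B j \<noteq> 1" using x q'0 by (simp add: B_def)
    have "(\<Sum>i\<in>UNIV. w $ i * B i) powr (1 / q') = 1" using one q'0 x0 by (simp add: power_mean_real B_def)
    then have "((\<Sum>i\<in>UNIV. w $ i * B i) powr (1 / q')) powr q' = 1" by simp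
    then have B1: "(\<Sum>i\<in>UNIV. w $ i * B i) = 1" using sum_pos[of q'] q'0 by (simp add: B_def powr_powr)
    show ?thesis
    proof (cases "q = 0")
      case True
      then have q': "0 < q'" using qq by simp
      have "q' * (\<Sum>i\<in>UNIV. w $ i * ln (x $ i)) = (\<Sum>i\<in>UNIV. w $ i * ln (B i))"
        using x0 by (simp add: B_def sum_distrib_left ln_powr mult_ac)
      also have "\<dots> < (\<Sum>i\<in>UNIV. w $ i * (1 + 1 * (B i - 1) - 1))"
      proof (rule sum_weight_less[OF w])
        show "ln (B i) \<le> 1 + 1 * (B i - 1) - 1" for i using ln_le_minus_one[OF B[of i]] by simp
        show "ln (B j) < 1 + 1 * (B j - 1) - 1"
          using ln_le_minus_one[OF B[of j]] ln_eq_minus_one[OF B[of j]] Bj by fastforce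
      qed
      also have "\<dots> = 0" using B1 weightD(2)[OF w] by (simp add: right_diff_distrib sum_subtractf)
      finally have "(\<Sum>i\<in>UNIV. w $ i * ln (x $ i)) < 0" using q' by (simp add: mult_less_0_iff)
      then show ?thesis using True lnprod by (simp add: zero_ereal_def)
    next
      case False
      define s where "s = q / q'"
      have xs: "x $ i powr q = B i powr s" for i using q'0 by (simp add: B_def s_def powr_powr)
      have aff: "(\<Sum>i\<in>UNIV. w $ i * (1 + s * (B i - 1))) = 1" using sum_weight_affine[OF w, of s B] B1 by simp
      show ?thesis
      proof (rule root)
        assume "q > 0"
        then have s: "0 < s" "s < 1" using qq by (auto simp: s_def field_simps)
        have "(\<Sum>i\<in>UNIV. w $ i * B i powr s) < (\<Sum>i\<in>UNIV. w $ i * (1 + s * (B i - 1)))"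
        proof (rule sum_weight_less[OF w])
          show "B i powr s \<le> 1 + s * (B i - 1)" for i
            using powr_less_tangent[OF B[of i] _ s] by (cases "B i = 1") auto
        qed (use powr_less_tangent[OF B Bj s] in auto)
        then show "(\<Sum>i\<in>UNIV. w $ i * x $ i powr q) < 1" by (simp add: xs aff)
      next
        assume "q < 0"
        \<comment> \<open>The quotient s is negative if the exponents have opposite signs, and
          exceeds 1 if both are negative.\<close>
        then have s: "s < 0 \<or> 1 < s" using qq q'0 by (cases "q' > 0") (auto simp: s_def field_simps)
        have "(\<Sum>i\<in>UNIV. w $ i * (1 + s * (B i - 1))) < (\<Sum>i\<in>UNIV. w $ i * B i powr s)"
        proof (rule sum_weight_less[OF w])
          show "1 + s * (B i - 1) \<le> B i powr s" for i
            using powr_greater_tangent[OF B[of i] _ s] by (cases "B i = 1") auto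
        qed (use powr_greater_tangent[OF B Bj s] in auto)
        then show "1 < (\<Sum>i\<in>UNIV. w $ i * x $ i powr q)" by (simp add: xs aff)
      qed fact
    qed
  qed
qed

text \<open>By homogeneity the mean with exponent q' is scaled to 1; as a is not constant, some
  scaled entry differs from 1. For q = -\<infinity> the minimum is compared through the finite
  exponent \<open>t' - 1\<close>.\<close>

lemma power_mean_strict_mono_exponent:
  fixes w a :: "real ^ 'm::finite" and q q' :: ereal
  assumes w: "is_weight w" and a: "\<And>i. 0 < a $ i" "a $ i \<noteq> a $ j" and qq: "q < q'" "q' \<noteq> \<infinity>"
  shows "power_mean w q a < power_mean w q' a"
proof -
  obtain t' where t': "q' = ereal t'" using qq by (cases q') auto
  have less: "power_mean w (ereal t) a < power_mean w q' a" if "t < t'" for t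
  proof -
    define m where "m = power_mean w q' a"
    have m: "0 < m" unfolding m_def by (rule power_mean_pos[OF w a(1)])
    define x where "x = (1 / m) *\<^sub>R a"
    have scale: "power_mean w p x = (1 / m) * power_mean w p a" for p
      unfolding x_def by (intro power_mean_scale w) (use m a(1) in \<open>auto simp: less_imp_le\<close>)
    have "x $ i \<noteq> x $ j" using a(2) m by (simp add: x_def)
    then obtain k where k: "x $ k \<noteq> 1" by metis
    have "power_mean w (ereal t) x < 1"
    proof (rule power_mean_normalized_less[OF w _ k that])
      show "power_mean w (ereal t') x = 1" using m by (simp add: scale m_def t')
    qed (use a m in \<open>simp add: x_def\<close>)
    then show ?thesis using m by (simp add: scale m_def field_simps)
  qed
  show ?thesis
  proof (cases q)
    case (real t)
    then show ?thesis using less[of t] qq t' by simp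
  next
    case MInf
    define k where "k = Min (range (($) a))"
    have "0 < k" unfolding k_def using a by (subst Min_gr_iff) auto
    have "k = power_mean w (ereal (t' - 1)) (\<chi> i. k)" using power_mean_const[OF w \<open>0 < k\<close>] by simp
    also have "\<dots> \<le> power_mean w (ereal (t' - 1)) a"
      by (intro power_mean_mono w) (use \<open>0 < k\<close> in simp, simp add: k_def)
    also have "\<dots> < power_mean w q' a" by (rule less) simp
    finally show ?thesis by (simp add: MInf power_mean_minfty k_def)
  qed (use qq in auto)
qed

lemma power_mean_mono_exponent:
  fixes w a :: "real ^ 'm::finite" and q q' :: ereal
  assumes w: "is_weight w" and a: "\<And>i. 0 < a $ i" and qq: "q < q'" "q' \<noteq> \<infinity>"
  shows "power_mean w q a \<le> power_mean w q' a"
proof (cases "\<exists>i j. a $ i \<noteq> a $ j")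
  case True
  then show ?thesis using power_mean_strict_mono_exponent[OF w a _ qq] by (auto intro: less_imp_le)
next
  case False
  then have "a = (\<chi> i. a $ undefined)" by (simp add: vec_eq_iff)
  then show ?thesis using power_mean_const[OF w a] by (metis order_refl)
qed

text \<open>With \<open>x = (\<chi> i. a $ i * r i ^ d)\<close> this is the case of equality in \<open>d\<close> successive applications of
  \<open>power_mean_Hoelder\<close>.\<close>

lemma power_mean_Hoelder_eq:
  fixes w a :: "real ^ 'm::finite" and d :: nat and q :: real
  assumes w: "is_weight w" and a: "\<And>i. 0 < a $ i" and d: "0 < d"
    and p: "p < ereal (1 / real d)" and q: "power_transform d p = ereal q"
  defines "r \<equiv> \<lambda>i. a $ i powr q / (\<Sum>i\<in>UNIV. w $ i * a $ i powr q)"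
  shows "power_mean w p (\<chi> i. a $ i * r i ^ d) = power_mean w (ereal q) a"
proof -
  define S where "S = (\<Sum>i\<in>UNIV. w $ i * a $ i powr q)"
  have a0: "a $ i \<noteq> 0" for i using a[of i] by simp
  have S: "0 < S" unfolding S_def by (intro sum_pos mult_pos_pos) (use weightD(1)[OF w] a0 in auto)
  have rd: "r i ^ d = a $ i powr (q * d) * S powr (- d)" for i
  proof -
    have "r i ^ d = (a $ i powr q) ^ d / S ^ d" by (simp add: r_def S_def power_divide)
    also have "(a $ i powr q) ^ d = a $ i powr (q * d)" using a0 by (simp add: powr_powr flip: powr_realpow)
    also have "\<dots> / S ^ d = a $ i powr (q * d) * S powr (- d)"
      using S by (simp add: powr_minus powr_realpow divide_inverse)
    finally show ?thesis .
  qed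
  have root: "power_mean w (ereal q) a = S powr (1 / q)" if "q \<noteq> 0"
    using that a0 by (simp add: power_mean_real S_def)
  consider "p = -\<infinity>" | "p = 0" | t where "p = ereal t" "t \<noteq> 0"
    using p by (cases p) (auto simp: zero_ereal_def)
  then show ?thesis
  proof cases
    case 1
    then have q: "q = - 1 / real d" using q by (simp add: power_transform_def)
    \<comment> \<open>Here q d = -1, so \<open>r i ^ d\<close> cancels \<open>a $ i\<close> and the
      tuple becomes constant.\<close>
    have "a $ i * r i ^ d = S powr (- d)" for i
      unfolding rd using a0 a[of i] d by (simp add: q powr_minus)
    moreover have "1 / q = - real d" "q \<noteq> 0" using d by (simp_all add: q)
    ultimately show ?thesis using root by (simp add: 1 power_mean_minfty image_constant_conv)
  next
    case 2
    then have q: "q = 0" using q d by (simp add: power_transform_def zero_ereal_def)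
    then have "S = 1" using a0 weightD(2)[OF w] by (simp add: S_def)
    then have "r i = 1" for i using q a0 by (simp add: r_def S_def)
    then show ?thesis using 2 q by (simp add: zero_ereal_def)
  next
    case 3
    then have td: "t * real d < 1" using p d by (simp add: field_simps)
    have q: "q = t / (1 - real d * t)" using q p 3 by (auto simp: power_transform_def)
    have q0: "q \<noteq> 0" using q td 3 by (auto simp: mult.commute)
    \<comment> \<open>Equivalent to q (1 - d t) = t; it makes the power t of each entry proportional
      to a_i^q, with a factor that does not depend on i.\<close>
    have e: "t + q * d * t = q" using td by (simp add: q field_simps)
    have e2: "(1 - d * t) / t = 1 / q" using td 3 by (simp add: q)
    have "(\<Sum>i\<in>UNIV. w $ i * (a $ i * r i ^ d) powr t) = (\<Sum>i\<in>UNIV. w $ i * a $ i powr q * S powr (- d * t))"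
    proof (intro sum.cong refl)
      fix i
      have "(a $ i * r i ^ d) powr t = a $ i powr (t + q * d * t) * S powr (- d * t)"
        unfolding rd using a[of i] S by (simp add: powr_mult powr_powr powr_add)
      then show "w $ i * (a $ i * r i ^ d) powr t = w $ i * a $ i powr q * S powr (- d * t)" by (simp add: e)
    qed
    also have "\<dots> = S powr 1 * S powr (- d * t)" using S by (simp add: S_def flip: sum_distrib_right)
    also have "\<dots> = S powr (1 - d * t)" using S by (simp add: powr_diff powr_minus divide_inverse)
    finally have "(\<Sum>i\<in>UNIV. w $ i * (a $ i * r i ^ d) powr t) powr (1 / t) = S powr (1 / q)"
      using 3 by (simp add: powr_powr e2[symmetric])
    moreover have "r i \<noteq> 0" for i using a0 S by (simp add: r_def flip: S_def)
    ultimately show ?thesis using 3 root[OF q0] a0 by (simp add: power_mean_real)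
  qed
qed

section \<open>Extremal cubes\<close>

text \<open>The half-sides s_i satisfy \<Sum> |b_i| s_i = \<Sum> w_i r_i = 1, so the weighted sum
  maps the product of the cubes into the cube of half-side 1, on which g_i equals a_i. The tuple of
  ratios is thus constantly a, while the r_i leave the volumes of the cubes free.\<close>

lemma ex_cube_functions:
  fixes w b a :: "real ^ 'm::finite" and r :: "'m \<Rightarrow> real"
  assumes w: "is_weight w" and b: "\<And>i. b $ i \<noteq> 0" and a: "\<And>i. 0 < a $ i" and r: "\<And>i. 0 < r i"
    and r1: "(\<Sum>i\<in>UNIV. w $ i * r i) = 1"
  shows "\<exists>f g :: 'm \<Rightarrow> real ^ 'd::finite \<Rightarrow> real. admissible f g \<and>
    ereal (power_mean w p a) \<le> K_const w p b f g \<and> norm_ratios w b f g = (\<chi> i. a $ i / r i ^ CARD('d))"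
proof -
  define s where "s i = w $ i * r i / \<bar>b $ i\<bar>" for i
  have s: "0 < s i" for i using weightD(1)[OF w, of i] r[of i] b[of i] by (simp add: s_def)
  define C where "C t = cbox (- t *\<^sub>R One) (t *\<^sub>R One :: real ^ 'd)" for t :: real
  have C: "x \<in> C t \<longleftrightarrow> (\<forall>v\<in>Basis. \<bar>x \<bullet> v\<bar> \<le> t)" for x t
    by (auto simp: C_def mem_box abs_le_iff minus_le_iff)
  have mC: "measure lebesgue (C t) = (2 * t) ^ CARD('d)" if "0 < t" for t
    using that by (simp add: C_def content_cbox_if box_eq_empty not_less inner_diff_left)
  have Cm: "C t \<in> lmeasurable" for t by (simp add: C_def)
  define f :: "'m \<Rightarrow> real ^ 'd \<Rightarrow> real" where "f i = indicator (C (s i))" for i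
  define g :: "'m \<Rightarrow> real ^ 'd \<Rightarrow> real" where "g i x = a $ i * indicator (C 1) x" for i x
  have int: "integrable lebesgue (indicator (C t) :: _ \<Rightarrow> real)" for t
    using Cm[of t] by (intro integrable_real_indicator) (auto simp: fmeasurable_def)
  have Lf: "L1_norm (f i) = (2 * s i) ^ CARD('d)" for i
    using mC[OF s[of i]] Cm[of "s i"] by (simp add: L1_norm_def f_def)
  have Lg: "L1_norm (g i) = a $ i * 2 ^ CARD('d)" for i
    using mC[of 1] Cm[of 1] a[of i] by (simp add: L1_norm_def g_def abs_mult)
  have "admissible f g"
    unfolding admissible_def
  proof (intro allI conjI)
    show "0 < L1_norm (f i)" for i unfolding Lf using s by simp
  qed (use int a in \<open>auto simp: f_def g_def[abs_def] less_imp_le\<close>)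
  moreover have "norm_ratios w b f g = (\<chi> i. a $ i / r i ^ CARD('d))"
  proof -
    have "(w $ i / \<bar>b $ i\<bar>) ^ CARD('d) * (L1_norm (g i) / L1_norm (f i)) = a $ i / r i ^ CARD('d)" for i
      unfolding Lf Lg s_def using weightD(1)[OF w, of i] b[of i] r[of i]
      by (simp add: power_mult_distrib power_divide)
    then show ?thesis by (simp add: norm_ratios_def)
  qed
  moreover have "ereal (power_mean w p a) \<le> K_const w p b f g"
    unfolding K_const_def ess_inf_def
  proof (intro Sup_upper CollectI AE_I2)
    fix x assume "x \<in> space (lebesgue_on (pos_prod f))"
    then have "\<forall>i. x $ i \<in> C (s i)"
      by (auto simp: space_restrict_space pos_prod_def pos_set_def f_def indicator_def split: if_splits)
    then have x: "x $ i \<in> C (s i)" for i ..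
    have "lin_comb b x \<in> C 1"
      unfolding C
    proof
      fix v :: "real ^ 'd" assume v: "v \<in> Basis"
      have "\<bar>lin_comb b x \<bullet> v\<bar> \<le> (\<Sum>i\<in>UNIV. \<bar>b $ i * (x $ i \<bullet> v)\<bar>)"
        unfolding lin_comb_def inner_sum_left inner_scaleR_left by (rule sum_abs)
      also have "\<dots> \<le> (\<Sum>i\<in>UNIV. w $ i * r i)"
      proof (rule sum_mono)
        fix i
        have "\<bar>b $ i\<bar> * \<bar>x $ i \<bullet> v\<bar> \<le> \<bar>b $ i\<bar> * s i" using x v by (intro mult_left_mono) (auto simp: C)
        then show "\<bar>b $ i * (x $ i \<bullet> v)\<bar> \<le> w $ i * r i" using b[of i] by (simp add: s_def abs_mult)
      qed
      finally show "\<bar>lin_comb b x \<bullet> v\<bar> \<le> 1" by (simp add: r1)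
    qed
    then have "(\<chi> i. g i (lin_comb b x) / f i (x $ i)) = a"
      using x by (simp add: vec_eq_iff f_def g_def)
    then show "ereal (power_mean w p a) \<le> ereal (power_mean w p (\<chi> i. g i (lin_comb b x) / f i (x $ i)))" by simp
  qed
  ultimately show ?thesis by blast
qed

text \<open>A non-constant tuple \<open>A\<close> strictly separates the means with exponents Q and
  q. Then r and a are chosen for equality in Hoelder's inequality: the norm ratios become
  \<open>A\<close>, and the mean of \<open>A\<close> with exponent q is the mean of a with exponent
  \<open>p'\<close>.\<close>

lemma ex_power_mean_less:
  fixes w :: "real ^ 'm::finite" and d :: nat
  assumes w: "is_weight w" and p: "p \<le> ereal (1 / real d)" and d: "0 < d" and m: "CARD('m) \<ge> 2"
    and Q: "Q < power_transform d p"
  shows "\<exists>(a :: real ^ 'm) r. (\<forall>i. 0 < a $ i) \<and> (\<forall>i. 0 < r i) \<and> (\<Sum>i\<in>UNIV. w $ i * r i) = 1 \<and>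
    power_mean w Q (\<chi> i. a $ i / r i ^ d) < power_mean w p a"
proof -
  \<comment> \<open>At p = 1 / d the transformed exponent is \<infinity>, outside the equality case.
    A smaller \<open>p'\<close> whose finite transform still exceeds Q takes its place.\<close>
  obtain p' q where p': "p' < ereal (1 / real d)" "power_transform d p' = ereal q" "Q < ereal q" "p' < p \<or> p' = p"
  proof (cases "p = ereal (1 / real d)")
    case True
    have "Q < \<infinity>" using Q by (cases Q) auto
    then obtain t where t: "Q < ereal t" using ereal_dense2 by blast
    define q where "q = max 1 t"
    \<comment> \<open>The preimage of q under p \<mapsto> p / (1 - d p); the choice q \<ge> 1 keeps
      the denominator positive.\<close>
    define u where "u = q / (1 + d * q)"
    have q: "0 < q" by (simp add: q_def)
    have dq: "0 < 1 + d * q" using q by (simp add: add_pos_nonneg)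
    have lt: "u < 1 / d" using q d dq by (simp add: u_def field_simps)
    have "1 - d * u = 1 / (1 + d * q)" using dq by (simp add: u_def field_simps)
    then have "u / (1 - d * u) = q" using dq by (simp add: u_def)
    then have "power_transform d (ereal u) = ereal q" using lt by (simp add: power_transform_def)
    moreover have "Q < ereal q" using t by (rule less_le_trans) (simp add: q_def)
    ultimately show ?thesis using that[of "ereal u" q] lt True by simp
  next
    case False
    then have lt: "p < ereal (1 / real d)" using p by simp
    then have "\<exists>q. power_transform d p = ereal q" by (auto simp: power_transform_def)
    then obtain q where "power_transform d p = ereal q" ..
    then show ?thesis using that[of p q] lt Q by simp
  qed
  obtain k l :: 'm where kl: "k \<noteq> l" using m by (metis card_2_iff' ex_card numeral_2_eq_2 UNIV_I)
  define A :: "real ^ 'm" where "A = (\<chi> i. if i = k then 1 else 2)"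
  have A: "0 < A $ i" for i by (simp add: A_def)
  have A0: "A $ i \<noteq> 0" for i using A[of i] by simp
  have Akl: "A $ k \<noteq> A $ l" using kl by (simp add: A_def)
  define S where "S = (\<Sum>i\<in>UNIV. w $ i * A $ i powr q)"
  have S: "0 < S" unfolding S_def by (intro sum_pos mult_pos_pos) (use weightD(1)[OF w] A0 in auto)
  define r where "r i = A $ i powr q / S" for i
  have r: "0 < r i" for i using A0 S by (simp add: r_def)
  define a where "a = (\<chi> i. A $ i * r i ^ d)"
  have a: "0 < a $ i" for i using A[of i] r[of i] by (simp add: a_def)
  have "(\<Sum>i\<in>UNIV. w $ i * r i) = S / S" by (simp add: r_def S_def flip: sum_divide_distrib)
  then have r1: "(\<Sum>i\<in>UNIV. w $ i * r i) = 1" using S by simp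
  have "a $ i / r i ^ d = A $ i" for i using r[of i] by (simp add: a_def)
  then have "(\<chi> i. a $ i / r i ^ d) = A" by (simp add: vec_eq_iff)
  then have "power_mean w Q (\<chi> i. a $ i / r i ^ d) = power_mean w Q A" by simp
  also have "\<dots> < power_mean w (ereal q) A"
    by (rule power_mean_strict_mono_exponent[OF w A Akl p'(3)]) simp
  also have "\<dots> = power_mean w p' a"
    using power_mean_Hoelder_eq[OF w A d p'(1,2)] by (simp add: a_def r_def S_def)
  also have "\<dots> \<le> power_mean w p a"
    using p'(4) p by (auto intro: power_mean_mono_exponent[OF w a])
  finally show ?thesis using a r r1 by blast
qed

theorem mainTheorem7:
  fixes w b :: "real ^ 'm::finite" and p :: ereal
  assumes "is_weight w"
    and "p \<le> ereal (1 / real CARD('d::finite))"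
    and "\<forall>i. b $ i \<noteq> 0"
  shows "is_least
      {C :: real. \<forall>f g :: 'm \<Rightarrow> real ^ 'd \<Rightarrow> real. admissible f g \<longrightarrow>
         K_const w p b f g
           \<le> ereal (C * power_mean w (power_transform CARD('d) p) (norm_ratios w b f g))}
      1
    \<and> (CARD('m) \<ge> 2 \<longrightarrow>
        (\<forall>Q :: ereal. Q < power_transform CARD('d) p \<longrightarrow>
          \<not> (\<forall>f g :: 'm \<Rightarrow> real ^ 'd \<Rightarrow> real. admissible f g \<longrightarrow>
               K_const w p b f g \<le> ereal (power_mean w Q (norm_ratios w b f g)))))"
proof (intro conjI impI allI)
  have b: "b $ i \<noteq> 0" for i using assms(3) by simp
  \<comment> \<open>Cubes with all r_i = 1: the norm ratios are 1 and the pointwise ratios are 1 on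
    the product of the cubes, which forces C \<ge> 1.\<close>
  obtain f g :: "'m \<Rightarrow> real ^ 'd \<Rightarrow> real" where fg: "admissible f g"
    "ereal (power_mean w p (\<chi> i. 1)) \<le> K_const w p b f g" "norm_ratios w b f g = (\<chi> i. 1)"
    using ex_cube_functions[where 'd='d and p=p and a="\<chi> i. 1" and r="\<lambda>_. 1", OF assms(1) b] weightD(2)[OF assms(1)]
    by auto
  have "1 \<le> C" if "K_const w p b f g \<le> ereal (C * power_mean w (power_transform CARD('d) p) (norm_ratios w b f g))" for C
  proof -
    have "ereal 1 \<le> K_const w p b f g" using fg(2) power_mean_const[OF assms(1), of 1] by simp
    also have "\<dots> \<le> ereal C" using that power_mean_const[OF assms(1), of 1] by (simp add: fg(3))
    finally show ?thesis by simp
  qed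
  then show "is_least
      {C :: real. \<forall>f g :: 'm \<Rightarrow> real ^ 'd \<Rightarrow> real. admissible f g \<longrightarrow>
         K_const w p b f g
           \<le> ereal (C * power_mean w (power_transform CARD('d) p) (norm_ratios w b f g))}
      1"
    unfolding is_least_def using K_const_le[OF assms(1,2) b] fg(1) by auto
next
  fix Q :: ereal
  assume m: "CARD('m) \<ge> 2" and Q: "Q < power_transform CARD('d) p"
  have b: "b $ i \<noteq> 0" for i using assms(3) by simp
  obtain a :: "real ^ 'm" and r where ar: "\<And>i. 0 < a $ i" "\<And>i. 0 < r i" "(\<Sum>i\<in>UNIV. w $ i * r i) = 1"
    and less: "power_mean w Q (\<chi> i. a $ i / r i ^ CARD('d)) < power_mean w p a"
    using ex_power_mean_less[OF assms(1,2) _ m Q] by auto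
  obtain f g :: "'m \<Rightarrow> real ^ 'd \<Rightarrow> real" where fg: "admissible f g"
    "ereal (power_mean w p a) \<le> K_const w p b f g" "norm_ratios w b f g = (\<chi> i. a $ i / r i ^ CARD('d))"
    using ex_cube_functions[OF assms(1) b ar] by blast
  have "ereal (power_mean w Q (norm_ratios w b f g)) < K_const w p b f g"
    by (rule less_le_trans[OF _ fg(2)]) (use less in \<open>simp add: fg(3)\<close>)
  then have "\<not> K_const w p b f g \<le> ereal (power_mean w Q (norm_ratios w b f g))"
    by (simp add: not_le)
  with fg(1) show "\<not> (\<forall>f g :: 'm \<Rightarrow> real ^ 'd \<Rightarrow> real. admissible f g \<longrightarrow>
      K_const w p b f g \<le> ereal (power_mean w Q (norm_ratios w b f g)))"
    by blast
qed

end
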